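(* Fix a base point $\widetilde{x}_0\in\widetilde{S}$. The set \[ Y=\left\{\xi\in\partial\widetilde{S}\ \middle|\ \text{there exist distinct geodesic rays } r_1,r_2 \text{ in } \widetilde{S} \text{ with } r_1(0)=\widetilde{x}_0=r_2(0) \text{ and } r_1(\infty)=\xi=r_2(\infty)\right\} \] is dense in $\partial\widetilde{S}$.
   Context: $S$ is a closed surface of genus $\geq 1$ equipped with a Euclidean metric (length metric) $d$ with finitely many conical singularities $s_1,\dots,s_n$: every other point has a neighborhood isometric to a Euclidean disk, and $s_i$ has a neighborhood isometric to a Euclidean cone of total angle $\theta(s_i)\in(0,+\infty)\setminus\{2\pi\}$ at its apex. It is assumed that at least one conical point has angle $<2\pi$, that $\pi_1(S)$ is hyperbolic in the sense of Gromov, and that the boundary $\partial\widetilde{S}$ below is homeomorphic to the circle $\mathbb{S}^1$ (for orientable $S$ the last two conditions mean genus $\geq 2$). Let $p:\widetilde{S}\to S$ be the universal covering, with $\widetilde{S}$ carrying the lifted metric for which $p$ is a local isometry; $\widetilde{S}$ is homeomorphic to $\mathbb{R}^2$ and is a proper Gromov hyperbolic geodesic space. A geodesic ray is a globally isometric embedding $r:[0,\infty)\to\widetilde{S}$. $\partial\widetilde{S}$ is the visual (Gromov) boundary of $\widetilde{S}$ defined by means of geodesic rays, and $r(\infty)\in\partial\widetilde{S}$ denotes the boundary point determined by $r$. $\xi_n\to\xi$ in $\partial\widetilde{S}$ means that there exist geodesic rays $r_n$ with $r_n(\infty)=\xi_n$ and $r$ with $r(\infty)=\xi$ (from the fixed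 base point) such that $r_n\to r$ uniformly on compact sets. *)

theory Defs
  imports "HOL-Analysis.Analysis" "HOL-Algebra.Generated_Groups" "HOL-Library.Extended_Nat"
begin

section \<open>Length metrics\<close>

definition curve_length :: "(real \<Rightarrow> 'a::metric_space) \<Rightarrow> ennreal" where
  "curve_length g =
     (SUP ts \<in> {ts. sorted ts \<and> set ts \<subseteq> {0..1}}.
        ennreal (\<Sum>i<length ts - 1. dist (g (ts ! i)) (g (ts ! Suc i))))"

text \<open>The infimum of the empty set is infinite, so a length space is path-connected.\<close>

definition length_space :: "'a::metric_space set \<Rightarrow> bool" where
  "length_space S \<longleftrightarrow>
     (\<forall>x\<in>S. \<forall>y\<in>S. ennreal (dist x y) =
        (INF g \<in> {g. path g \<and> path_image g \<subseteq> S \<and> pathstart g = x \<and> pathfinish g = y}.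
           curve_length g))"


section \<open>Closed surfaces and their genus\<close>

definition closed_surface :: "'a::metric_space set \<Rightarrow> bool" where
  "closed_surface S \<longleftrightarrow>
     S \<noteq> {} \<and> compact S \<and> connected S \<and>
     (\<forall>x\<in>S. \<exists>U. openin (top_of_set S) U \<and> x \<in> U \<and> U homeomorphic (UNIV :: complex set))"

definition simple_closed_curve :: "'a::topological_space set \<Rightarrow> bool" where
  "simple_closed_curve c \<longleftrightarrow>
     (\<exists>g. simple_path g \<and> pathfinish g = pathstart g \<and> path_image g = c)"

text \<open>
  The maximal number of pairwise disjoint simple closed curves which together do not separate
  the surface. This is the number of handles of an orientable and the number of cross-caps of
  a non-orientable closed surface.
\<close>

definition genus :: "'a::metric_space set \<Rightarrow> enat" where
  "genus S =
     (SUP C \<in> {C. finite C \<and> (\<forall>c\<in>C. simple_closed_curve c) \<and> pairwise disjnt C \<and>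
                   \<Union>C \<subseteq> S \<and> connected (S - \<Union>C)}.
        enat (card C))"


section \<open>Euclidean metrics with conical singularities\<close>

text \<open>
  The Euclidean cone of total angle \<open>\<theta>\<close> in polar coordinates \<open>(r, a)\<close>, where the angle \<open>a\<close> is
  taken modulo \<open>\<theta>\<close> and the apex is represented by \<open>(0, 0)\<close>. Two points whose angular distance
  is less than \<open>\<pi>\<close> are joined by a straight segment in a planar sector, so that their distance is
  given by the law of cosines; otherwise the shortest path runs through the apex and has length
  \<open>r + s\<close>.
\<close>

definition cone :: "real \<Rightarrow> (real \<times> real) set" where
  "cone \<theta> = insert (0, 0) ({0<..} \<times> {0..<\<theta>})"

definition cone_angle_dist :: "real \<Rightarrow> real \<Rightarrow> real \<Rightarrow> real" where
  "cone_angle_dist \<theta> a b = min \<bar>a - b\<bar> (\<theta> - \<bar>a - b\<bar>)"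

definition cone_dist :: "real \<Rightarrow> real \<times> real \<Rightarrow> real \<times> real \<Rightarrow> real" where
  "cone_dist \<theta> = (\<lambda>(r, a) (s, b).
     sqrt (r\<^sup>2 + s\<^sup>2 - 2 * r * s * cos (min pi (cone_angle_dist \<theta> a b))))"

definition euclidean_at :: "'a::metric_space \<Rightarrow> bool" where
  "euclidean_at x \<longleftrightarrow>
     (\<exists>U e (f :: 'a \<Rightarrow> real^2). open U \<and> x \<in> U \<and> e > 0 \<and> f ` U = ball 0 e \<and>
        (\<forall>y\<in>U. \<forall>z\<in>U. dist (f y) (f z) = dist y z))"

definition conical_at :: "real \<Rightarrow> 'a::metric_space \<Rightarrow> bool" where
  "conical_at \<theta> x \<longleftrightarrow>
     (\<exists>U e (f :: 'a \<Rightarrow> real \<times> real). open U \<and> x \<in> U \<and> e > 0 \<and>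
        f ` U = {q \<in> cone \<theta>. fst q < e} \<and> f x = (0, 0) \<and>
        (\<forall>y\<in>U. \<forall>z\<in>U. cone_dist \<theta> (f y) (f z) = dist y z))"

definition euclidean_cone_metric :: "'a::metric_space set \<Rightarrow> ('a \<Rightarrow> real) \<Rightarrow> bool" where
  "euclidean_cone_metric P \<theta> \<longleftrightarrow>
     length_space (UNIV :: 'a set) \<and> finite P \<and>
     (\<forall>x. x \<notin> P \<longrightarrow> euclidean_at x) \<and>
     (\<forall>s\<in>P. 0 < \<theta> s \<and> \<theta> s \<noteq> 2 * pi \<and> conical_at (\<theta> s) s)"


section \<open>Universal covering with the lifted metric\<close>

definition local_isometry :: "('b::metric_space \<Rightarrow> 'a::metric_space) \<Rightarrow> bool" where
  "local_isometry p \<longleftrightarrow>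
     (\<forall>x. \<exists>e>0. p ` ball x e = ball (p x) e \<and>
        (\<forall>y\<in>ball x e. \<forall>z\<in>ball x e. dist (p y) (p z) = dist y z))"

text \<open>The lifted metric is the unique length metric for which \<open>p\<close> is a local isometry.\<close>

definition metric_universal_covering :: "('b::metric_space \<Rightarrow> 'a::metric_space) \<Rightarrow> bool" where
  "metric_universal_covering p \<longleftrightarrow>
     covering_space UNIV p UNIV \<and> simply_connected (UNIV :: 'b set) \<and>
     length_space (UNIV :: 'b set) \<and> local_isometry p"


section \<open>The fundamental group\<close>

definition loops_at :: "'a::topological_space \<Rightarrow> (real \<Rightarrow> 'a) set" where
  "loops_at x = {g. path g \<and> pathstart g = x \<and> pathfinish g = x}"

definition homotopy_class :: "(real \<Rightarrow> 'a::topological_space) \<Rightarrow> (real \<Rightarrow> 'a) set" where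
  "homotopy_class g = {h. homotopic_paths UNIV g h}"

definition fundamental_group :: "'a::topological_space \<Rightarrow> (real \<Rightarrow> 'a) set monoid" where
  "fundamental_group x =
     \<lparr>carrier = homotopy_class ` loops_at x,
      mult = (\<lambda>A B. \<Union>g\<in>A. \<Union>h\<in>B. homotopy_class (g +++ h)),
      one = homotopy_class (\<lambda>_. x)\<rparr>"

text \<open>
  The library states the unit and inverse laws for paths in real normed vector spaces only.
\<close>

lemma homotopic_paths_const_right:
  fixes g :: "real \<Rightarrow> 'a::topological_space"
  assumes "path g" "pathfinish g = x"
  shows "homotopic_paths UNIV (g +++ (\<lambda>_. x)) g"
proof -
  have "continuous_on {0..1} (\<lambda>t::real. if t \<le> 1/2 then 2 * t else 1)"
    unfolding split_01
    by (rule continuous_on_cases continuous_intros | force)+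
  then have "homotopic_paths UNIV g (g +++ (\<lambda>_. x))"
    using assms
    by (intro homotopic_paths_reparametrize[where f = "\<lambda>t. if t \<le> 1/2 then 2 * t else 1"])
       (auto simp: joinpaths_def pathfinish_def)
  then show ?thesis
    by (rule homotopic_paths_sym)
qed

lemma homotopic_paths_const_left:
  fixes g :: "real \<Rightarrow> 'a::topological_space"
  assumes "path g" "pathstart g = x"
  shows "homotopic_paths UNIV ((\<lambda>_. x) +++ g) g"
proof -
  have "homotopic_paths UNIV (reversepath g +++ (\<lambda>_. x)) (reversepath g)"
    using assms by (intro homotopic_paths_const_right) auto
  then have "homotopic_paths UNIV (reversepath (reversepath g +++ (\<lambda>_. x))) g"
    using homotopic_paths_reversepath_D by fastforce
  moreover have "reversepath (reversepath g +++ (\<lambda>_. x)) = reversepath (\<lambda>_. x) +++ g"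
    using assms by (subst reversepath_joinpaths) (auto simp: pathstart_def)
  moreover have "reversepath (\<lambda>_::real. x) = (\<lambda>_. x)"
    by (simp add: reversepath_def)
  ultimately show ?thesis
    by simp
qed

lemma homotopic_paths_reversepath_left:
  fixes g :: "real \<Rightarrow> 'a::topological_space"
  assumes "path g" "pathfinish g = x"
  shows "homotopic_paths UNIV (reversepath g +++ g) (\<lambda>_. x)"
proof -
  define \<phi> :: "real \<Rightarrow> real" where "\<phi> = (\<lambda>t. \<bar>2 * t - 1\<bar>)"
  define h :: "real \<times> real \<Rightarrow> 'a" where
    "h = (\<lambda>(s, t). g (\<phi> t + s * (1 - \<phi> t)))"
  have range: "\<phi> t + s * (1 - \<phi> t) \<in> {0..1}" if "s \<in> {0..1}" "t \<in> {0..1}" for s t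
  proof -
    have \<phi>: "0 \<le> \<phi> t" "\<phi> t \<le> 1"
      using that by (auto simp: \<phi>_def)
    have "0 \<le> \<phi> t + s * (1 - \<phi> t)" "0 \<le> (1 - s) * (1 - \<phi> t)"
      using that \<phi> by (intro add_nonneg_nonneg mult_nonneg_nonneg; simp)+
    then show ?thesis
      by (simp add: algebra_simps)
  qed
  have "continuous_on {0..1} g"
    using assms by (simp add: path_def)
  then have "continuous_on ({0..1} \<times> {0..1}) h"
    unfolding h_def case_prod_beta
  proof (rule continuous_on_compose2)
    show "continuous_on ({0..1} \<times> {0..1}) (\<lambda>y. \<phi> (snd y) + fst y * (1 - \<phi> (snd y)))"
      unfolding \<phi>_def by (intro continuous_intros)
  qed (use range in auto)
  moreover have "h (0, t) = (reversepath g +++ g) t" for t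
    by (auto simp: h_def \<phi>_def joinpaths_def reversepath_def)
  moreover have "h (1, t) = x" for t
    using assms by (simp add: h_def pathfinish_def)
  moreover have "h (s, 0) = x" "h (s, 1) = x" for s
    using assms by (simp_all add: h_def \<phi>_def pathfinish_def)
  ultimately show ?thesis
    unfolding homotopic_paths using assms
    by (intro exI[of _ h]) (auto simp: pathstart_def pathfinish_def joinpaths_def reversepath_def)
qed

lemma homotopy_class_eq_iff:
  assumes "path g"
  shows "homotopy_class g = homotopy_class h \<longleftrightarrow> homotopic_paths UNIV g h"
  using assms homotopic_paths_sym homotopic_paths_trans homotopic_paths_refl[of UNIV]
  unfolding homotopy_class_def by blast

lemma mult_fundamental_group:
  assumes "g \<in> loops_at x" "h \<in> loops_at x"
  shows "homotopy_class g \<otimes>\<^bsub>fundamental_group x\<^esub> homotopy_class h = homotopy_class (g +++ h)"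
proof -
  have "homotopy_class (g' +++ h') = homotopy_class (g +++ h)"
    if "homotopic_paths UNIV g g'" "homotopic_paths UNIV h h'" for g' h'
  proof -
    have "homotopic_paths UNIV (g +++ h) (g' +++ h')"
      using that assms by (intro homotopic_paths_join) (auto simp: loops_at_def)
    moreover have "path (g +++ h)"
      using assms by (auto simp: loops_at_def)
    ultimately show ?thesis
      using homotopy_class_eq_iff by metis
  qed
  then have "(\<Union>g'\<in>homotopy_class g. \<Union>h'\<in>homotopy_class h. homotopy_class (g' +++ h')) =
      (\<Union>g'\<in>homotopy_class g. \<Union>h'\<in>homotopy_class h. homotopy_class (g +++ h))"
    by (intro SUP_cong refl) (simp add: homotopy_class_def)
  moreover have "g \<in> homotopy_class g" "h \<in> homotopy_class h"
    using assms by (simp_all add: homotopy_class_def loops_at_def)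
  then have "homotopy_class g \<noteq> {}" "homotopy_class h \<noteq> {}"
    by blast+
  ultimately show ?thesis
    by (simp add: fundamental_group_def)
qed

lemma group_fundamental_group: "group (fundamental_group x)"
proof (rule groupI)
  let ?G = "fundamental_group x"
  have carrier: "carrier ?G = homotopy_class ` loops_at x"
    by (simp add: fundamental_group_def)
  have const: "(\<lambda>_. x) \<in> loops_at x"
    by (auto simp: loops_at_def path_def pathstart_def pathfinish_def)
  have one: "\<one>\<^bsub>?G\<^esub> = homotopy_class (\<lambda>_. x)"
    by (simp add: fundamental_group_def)
  have join: "g +++ h \<in> loops_at x" if "g \<in> loops_at x" "h \<in> loops_at x" for g h
    using that by (auto simp: loops_at_def)
  show "\<one>\<^bsub>?G\<^esub> \<in> carrier ?G"
    using const by (auto simp: carrier one)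
  show "A \<otimes>\<^bsub>?G\<^esub> B \<in> carrier ?G" if "A \<in> carrier ?G" "B \<in> carrier ?G" for A B
    using that join by (auto simp: carrier mult_fundamental_group)
  show "A \<otimes>\<^bsub>?G\<^esub> B \<otimes>\<^bsub>?G\<^esub> C = A \<otimes>\<^bsub>?G\<^esub> (B \<otimes>\<^bsub>?G\<^esub> C)"
    if ABC_carrier: "A \<in> carrier ?G" "B \<in> carrier ?G" "C \<in> carrier ?G" for A B C
  proof -
    obtain a b c where abc: "a \<in> loops_at x" "b \<in> loops_at x" "c \<in> loops_at x"
      and ABC: "A = homotopy_class a" "B = homotopy_class b" "C = homotopy_class c"
      using ABC_carrier unfolding carrier by blast
    have "homotopic_paths UNIV (a +++ (b +++ c)) ((a +++ b) +++ c)"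
      using abc by (intro homotopic_paths_assoc) (auto simp: loops_at_def)
    moreover have "path (a +++ (b +++ c))"
      using abc by (auto simp: loops_at_def)
    ultimately show ?thesis
      using homotopy_class_eq_iff abc join by (metis ABC mult_fundamental_group)
  qed
  show "\<one>\<^bsub>?G\<^esub> \<otimes>\<^bsub>?G\<^esub> A = A" if A: "A \<in> carrier ?G" for A
  proof -
    obtain a where a: "a \<in> loops_at x" "A = homotopy_class a"
      using A unfolding carrier by blast
    have "homotopic_paths UNIV ((\<lambda>_. x) +++ a) a"
      using a by (intro homotopic_paths_const_left) (auto simp: loops_at_def)
    then have "homotopy_class ((\<lambda>_. x) +++ a) = homotopy_class a"
      using homotopy_class_eq_iff homotopic_paths_imp_path by metis
    then show ?thesis
      using a const by (simp add: one mult_fundamental_group)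
  qed
  show "\<exists>B\<in>carrier ?G. B \<otimes>\<^bsub>?G\<^esub> A = \<one>\<^bsub>?G\<^esub>" if A: "A \<in> carrier ?G" for A
  proof -
    obtain a where a: "a \<in> loops_at x" "A = homotopy_class a"
      using A unfolding carrier by blast
    have rev: "reversepath a \<in> loops_at x"
      using a by (auto simp: loops_at_def)
    have "homotopic_paths UNIV (reversepath a +++ a) (\<lambda>_. x)"
      using a by (intro homotopic_paths_reversepath_left) (auto simp: loops_at_def)
    then have "homotopy_class (reversepath a +++ a) = homotopy_class (\<lambda>_. x)"
      using homotopy_class_eq_iff homotopic_paths_imp_path by metis
    then show ?thesis
      using a rev by (auto simp: carrier one mult_fundamental_group)
  qed
qed


section \<open>Gromov hyperbolicity\<close>

definition gromov_product :: "('x \<Rightarrow> 'x \<Rightarrow> real) \<Rightarrow> 'x \<Rightarrow> 'x \<Rightarrow> 'x \<Rightarrow> real" where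
  "gromov_product d w x y = (d x w + d y w - d x y) / 2"

definition gromov_hyperbolic :: "'x set \<Rightarrow> ('x \<Rightarrow> 'x \<Rightarrow> real) \<Rightarrow> bool" where
  "gromov_hyperbolic M d \<longleftrightarrow>
     (\<exists>\<delta>\<ge>0. \<forall>w\<in>M. \<forall>x\<in>M. \<forall>y\<in>M. \<forall>z\<in>M.
        gromov_product d w x z \<ge> min (gromov_product d w x y) (gromov_product d w y z) - \<delta>)"

definition word_length :: "('g, 'm) monoid_scheme \<Rightarrow> 'g set \<Rightarrow> 'g \<Rightarrow> nat" where
  "word_length G A g =
     (LEAST n. \<exists>ws. length ws = n \<and> set ws \<subseteq> A \<union> m_inv G ` A \<and>
        foldr (mult G) ws (one G) = g)"

definition word_dist :: "('g, 'm) monoid_scheme \<Rightarrow> 'g set \<Rightarrow> 'g \<Rightarrow> 'g \<Rightarrow> real" where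
  "word_dist G A g h = real (word_length G A (inv\<^bsub>G\<^esub> g \<otimes>\<^bsub>G\<^esub> h))"

definition hyperbolic_group :: "('g, 'm) monoid_scheme \<Rightarrow> bool" where
  "hyperbolic_group G \<longleftrightarrow>
     group G \<and>
     (\<exists>A. finite A \<and> A \<subseteq> carrier G \<and> generate G A = carrier G \<and>
        gromov_hyperbolic (carrier G) (word_dist G A))"


section \<open>Geodesic rays and the visual boundary\<close>

text \<open>Rays are defined on \<open>[0, \<infinity>)\<close>; their values at negative arguments are irrelevant.\<close>

definition geodesic_ray :: "(real \<Rightarrow> 'b::metric_space) \<Rightarrow> bool" where
  "geodesic_ray r \<longleftrightarrow> (\<forall>s\<ge>0. \<forall>t\<ge>0. dist (r s) (r t) = \<bar>s - t\<bar>)"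

definition asymptotic_rays :: "((real \<Rightarrow> 'b::metric_space) \<times> (real \<Rightarrow> 'b)) set" where
  "asymptotic_rays =
     {(r, r'). geodesic_ray r \<and> geodesic_ray r' \<and> (\<exists>K. \<forall>t\<ge>0. dist (r t) (r' t) \<le> K)}"

definition visual_boundary :: "(real \<Rightarrow> 'b::metric_space) set set" where
  "visual_boundary = Collect geodesic_ray // asymptotic_rays"

definition ray_end :: "(real \<Rightarrow> 'b::metric_space) \<Rightarrow> (real \<Rightarrow> 'b) set" where
  "ray_end r = asymptotic_rays `` {r}"

lemma equiv_asymptotic_rays:
  "equiv (Collect geodesic_ray) (asymptotic_rays :: ((real \<Rightarrow> 'b::metric_space) \<times> _) set)"
  (is "equiv ?A ?R")
proof (rule equivI)
  show "?R \<subseteq> ?A \<times> ?A"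
    by (auto simp: asymptotic_rays_def)
  show "refl_on ?A ?R"
    by (auto simp: refl_on_def asymptotic_rays_def intro: exI[of _ 0])
  show "sym ?R"
    by (auto simp: sym_def asymptotic_rays_def dist_commute)
  show "trans ?R"
  proof (rule transI)
    fix q r s :: "real \<Rightarrow> 'b"
    assume "(q, r) \<in> asymptotic_rays" "(r, s) \<in> asymptotic_rays"
    then obtain K L where *: "geodesic_ray q" "geodesic_ray s"
      "\<And>t. t \<ge> 0 \<Longrightarrow> dist (q t) (r t) \<le> K" "\<And>t. t \<ge> 0 \<Longrightarrow> dist (r t) (s t) \<le> L"
      by (auto simp: asymptotic_rays_def)
    have "dist (q t) (s t) \<le> K + L" if "t \<ge> 0" for t
      using dist_triangle[of "q t" "s t" "r t"] *(3,4)[OF that] by linarith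
    with *(1,2) show "(q, s) \<in> asymptotic_rays"
      by (auto simp: asymptotic_rays_def)
  qed
qed

definition boundary_converges ::
    "'b::metric_space \<Rightarrow> (nat \<Rightarrow> (real \<Rightarrow> 'b) set) \<Rightarrow> (real \<Rightarrow> 'b) set \<Rightarrow> bool" where
  "boundary_converges x \<xi>s \<xi> \<longleftrightarrow>
     (\<exists>rs r. (\<forall>n. geodesic_ray (rs n) \<and> rs n 0 = x \<and> ray_end (rs n) = \<xi>s n) \<and>
        geodesic_ray r \<and> r 0 = x \<and> ray_end r = \<xi> \<and>
        (\<forall>K. compact K \<and> K \<subseteq> {0..} \<longrightarrow> uniform_limit K rs r sequentially))"

text \<open>
  The topology of the visual boundary is the sequential topology of this convergence. Since rays
  with the same end need not coincide, a sequence may converge topologically although only its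
  subsequences have convergent choices of rays; the closed sets are not affected by this.
\<close>

definition boundary_topology :: "'b::metric_space \<Rightarrow> (real \<Rightarrow> 'b) set topology" where
  "boundary_topology x =
     topology (\<lambda>U. U \<subseteq> visual_boundary \<and>
       (\<forall>\<xi>\<in>U. \<forall>\<xi>s. boundary_converges x \<xi>s \<xi> \<longrightarrow> eventually (\<lambda>n. \<xi>s n \<in> U) sequentially))"

lemma openin_boundary_topology:
  fixes x :: "'b::metric_space"
  shows "openin (boundary_topology x) U \<longleftrightarrow>
     U \<subseteq> visual_boundary \<and>
     (\<forall>\<xi>\<in>U. \<forall>\<xi>s. boundary_converges x \<xi>s \<xi> \<longrightarrow> eventually (\<lambda>n. \<xi>s n \<in> U) sequentially)"
proof -
  have "istopology (\<lambda>U. U \<subseteq> visual_boundary \<and>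
    (\<forall>\<xi>\<in>U. \<forall>\<xi>s. boundary_converges x \<xi>s \<xi> \<longrightarrow> eventually (\<lambda>n. \<xi>s n \<in> U) sequentially))"
    unfolding istopology_def
  proof (intro conjI allI impI)
    fix \<K> :: "(real \<Rightarrow> 'b) set set set"
    assume *: "\<forall>K\<in>\<K>. K \<subseteq> visual_boundary \<and>
      (\<forall>\<xi>\<in>K. \<forall>\<xi>s. boundary_converges x \<xi>s \<xi> \<longrightarrow> eventually (\<lambda>n. \<xi>s n \<in> K) sequentially)"
    then show "\<Union>\<K> \<subseteq> visual_boundary"
      by blast
    show "\<forall>\<xi>\<in>\<Union>\<K>. \<forall>\<xi>s. boundary_converges x \<xi>s \<xi> \<longrightarrow>
        eventually (\<lambda>n. \<xi>s n \<in> \<Union>\<K>) sequentially"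
    proof (intro ballI allI impI)
      fix \<xi> \<xi>s
      assume "\<xi> \<in> \<Union>\<K>" and conv: "boundary_converges x \<xi>s \<xi>"
      then obtain K where K: "K \<in> \<K>" "\<xi> \<in> K"
        by blast
      then have "eventually (\<lambda>n. \<xi>s n \<in> K) sequentially"
        using * conv by blast
      then show "eventually (\<lambda>n. \<xi>s n \<in> \<Union>\<K>) sequentially"
        by (rule eventually_mono) (use K in blast)
    qed
  qed (auto intro: eventually_conj)
  then show ?thesis
    by (simp add: boundary_topology_def)
qed

lemma topspace_boundary_topology: "topspace (boundary_topology x) = visual_boundary"
proof
  show "topspace (boundary_topology x) \<subseteq> visual_boundary"
    using openin_boundary_topology[of x "topspace (boundary_topology x)"] by simp
  have "\<xi>s n \<in> visual_boundary" if "boundary_converges x \<xi>s \<xi>" for \<xi>s :: "nat \<Rightarrow> _" and \<xi> n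
    using that unfolding boundary_converges_def visual_boundary_def
    by (metis mem_Collect_eq quotientI ray_end_def)
  then have "openin (boundary_topology x) visual_boundary"
    by (auto simp: openin_boundary_topology)
  then show "visual_boundary \<subseteq> topspace (boundary_topology x)"
    by (rule openin_subset)
qed

end

theory Submission
  imports Defs "HOL-Library.Diagonal_Subsequence"
begin

text \<open>
  Suppose that a nonempty open set of boundary points contains no end of two different rays from
  \<open>x0\<close>. As the boundary is a circle, the open set contains an arc. Every point of the arc is the
  end of exactly one ray from \<open>x0\<close>; let \<open>F s\<close> be the ray of the parameter \<open>s \<in> {a..b}\<close>. By
  compactness of the space of rays and uniqueness, \<open>F s t\<close> is continuous in \<open>s\<close>. Two such rays which
  meet agree up to the meeting time, since exchanging their initial pieces gives another ray with
  the same end.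

  The rays of the sector \<open>F\<close> sweep out a closed set, and the main point is that it contains every
  ball around a point of the sector that stays away from \<open>x0\<close> and the two extreme rays
  (\<open>ball_subset_swept\<close>). For this it has to be shown that a swept regular point is interior to the
  swept set (\<open>swept_interior\<close>). In a Euclidean chart the nearby rays are segments, depending
  continuously on \<open>s\<close>. If rays with parameters on the two sides of \<open>s\<close> pass the point on different
  sides, the intermediate value theorem shows that a neighbourhood is covered. If they pass on the
  same side, the family folds back and covers every point of a small segment at least twice; each of
  these pairs of rays has to separate later, which is possible at a singular point only, and
  different points of the segment give different singular points. As there are only countably many
  singular points, the family does not fold.
  Finally, removing the singular points does not disconnect small balls around them, so that the
  swept part of the ball is all of it.

  Since the two extreme rays are not asymptotic, there are such balls of arbitrary radius
  (\<open>no_dense_small_cones\<close>). By compactness of the surface a large ball contains a cone point of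
  angle less than \<open>2\<pi>\<close>. So some ray runs through this point; but a geodesic cannot, because on one
  side the angle at the point would be less than \<open>\<pi>\<close> and leave room for a shortcut.
\<close>

section \<open>Curve length and length spaces\<close>

lemma dist_le_sum_dist:
  fixes f :: "nat \<Rightarrow> 'a::metric_space"
  shows "dist (f 0) (f n) \<le> (\<Sum>i<n. dist (f i) (f (Suc i)))"
proof (induction n)
  case (Suc n)
  then show ?case
    using dist_triangle[of "f 0" "f (Suc n)" "f n"] by simp
qed simp

lemma sum_dist_le_curve_length:
  assumes "sorted ts" "set ts \<subseteq> {0..1}"
  shows "ennreal (\<Sum>i<length ts - 1. dist (g (ts ! i)) (g (ts ! Suc i))) \<le> curve_length g"
  unfolding curve_length_def using assms by (intro SUP_upper) simp

lemma dist_add_dist_le_curve_length: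
  assumes "t \<in> {0..1}"
  shows "ennreal (dist (g 0) (g t) + dist (g t) (g 1)) \<le> curve_length g"
  using sum_dist_le_curve_length[of "[0, t, 1]" g] assms by (simp add: numeral_2_eq_2)

text \<open>
  The image \<open>h\<close> of \<open>g\<close> under a locally nonexpanding map is no longer than \<open>g\<close>. Stated for the
  two curves in place of a map, the lemma serves for curves pushed down to the base of a
  covering and for curves lifted to its total space.
\<close>

lemma dist_le_curve_length_of_local:
  fixes g :: "real \<Rightarrow> 'a::metric_space" and h :: "real \<Rightarrow> 'b::metric_space"
  assumes loc: "\<And>t. t \<in> {0..1} \<Longrightarrow> \<exists>d>0. \<forall>u\<in>{0..1}. \<forall>v\<in>{0..1}. \<bar>u - t\<bar> < d \<longrightarrow> \<bar>v - t\<bar> < d \<longrightarrow>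
      dist (h u) (h v) \<le> dist (g u) (g v)"
  shows "ennreal (dist (h 0) (h 1)) \<le> curve_length g"
proof -
  obtain d where d: "\<And>t. t \<in> {0..1} \<Longrightarrow> d t > 0"
    and dle: "\<And>t u v. t \<in> {0..1} \<Longrightarrow> u \<in> {0..1} \<Longrightarrow> v \<in> {0..1} \<Longrightarrow> \<bar>u - t\<bar> < d t \<Longrightarrow> \<bar>v - t\<bar> < d t \<Longrightarrow>
      dist (h u) (h v) \<le> dist (g u) (g v)"
    using loc by metis
  have "{0..1} \<subseteq> \<Union> ((\<lambda>t. ball t (d t)) ` {0..1})"
    using d by force
  then obtain e where e: "e > 0" "\<And>x. x \<in> {0..1::real} \<Longrightarrow> \<exists>G\<in>(\<lambda>t. ball t (d t)) ` {0..1}. ball x e \<subseteq> G"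
    using Heine_Borel_lemma[of "{0..1::real}" "(\<lambda>t. ball t (d t)) ` {0..1}"] by (metis (no_types, lifting) compact_Icc imageE open_ball)
  obtain n where n: "inverse (real (Suc n)) < e"
    using e(1) reals_Archimedean by blast
  define N where "N = Suc n"
  define f where "f i = real i / real N" for i
  define ts where "ts = map f [0..<Suc N]"
  have N: "N > 0" by (simp add: N_def)
  have f01: "f i \<in> {0..1}" if "i \<le> N" for i
    using that N by (simp add: f_def)
  have step: "dist (h (f i)) (h (f (Suc i))) \<le> dist (g (f i)) (g (f (Suc i)))" if "i < N" for i
  proof -
    have "f i \<in> {0..1}" "f (Suc i) \<in> {0..1}" using f01 that by auto
    moreover obtain t where t: "t \<in> {0..1}" "ball (f i) e \<subseteq> ball t (d t)"
      using e(2)[OF \<open>f i \<in> {0..1}\<close>] by auto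
    have "f (Suc i) - f i = inverse (real N)"
      by (simp add: f_def diff_divide_distrib[symmetric] inverse_eq_divide)
    then have "f (Suc i) \<in> ball (f i) e"
      using n by (simp add: N_def dist_real_def abs_minus_commute[of "f i"] del: of_nat_Suc)
    moreover have "f i \<in> ball (f i) e" using e by simp
    ultimately have "\<bar>f i - t\<bar> < d t" "\<bar>f (Suc i) - t\<bar> < d t"
      using t(2) by (auto simp: dist_commute[of t] subset_iff dist_real_def[symmetric])
    then show ?thesis
      using dle t(1) \<open>f i \<in> {0..1}\<close> \<open>f (Suc i) \<in> {0..1}\<close> by blast
  qed
  have "sorted ts"
    unfolding ts_def sorted_iff_nth_mono using N by (auto simp: f_def field_simps simp del: upt_Suc)
  moreover have "set ts \<subseteq> {0..1}"
    unfolding ts_def using f01 by auto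
  ultimately have le: "ennreal (\<Sum>i<length ts - 1. dist (g (ts ! i)) (g (ts ! Suc i))) \<le> curve_length g"
    by (rule sum_dist_le_curve_length)
  have "f 0 = 0" "f N = 1" using N by (auto simp: f_def)
  then have "dist (h 0) (h 1) \<le> (\<Sum>i<N. dist (h (f i)) (h (f (Suc i))))"
    using dist_le_sum_dist[of "\<lambda>i. h (f i)" N] by simp
  also have "\<dots> \<le> (\<Sum>i<N. dist (g (f i)) (g (f (Suc i))))"
    using step by (intro sum_mono) auto
  also have "\<dots> = (\<Sum>i<length ts - 1. dist (g (ts ! i)) (g (ts ! Suc i)))"
    unfolding ts_def by (rule sum.cong) (auto simp del: upt_Suc)
  finally show ?thesis
    using le by (meson ennreal_leI order_trans)
qed

lemma length_space_short_path:
  fixes x y :: "'a::metric_space"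
  assumes "length_space (UNIV :: 'a set)" "dist x y < r"
  obtains g where "path g" "g 0 = x" "g 1 = y" "curve_length g < ennreal r"
proof -
  have "(INF g \<in> {g. path g \<and> path_image g \<subseteq> UNIV \<and> pathstart g = x \<and> pathfinish g = y}.
           curve_length g) = ennreal (dist x y)"
    using assms(1) unfolding length_space_def by simp
  also have "\<dots> < ennreal r"
    using assms(2) by (simp add: ennreal_less_iff)
  finally show ?thesis
    using that unfolding INF_less_iff by (auto simp: pathstart_def pathfinish_def)
qed

text \<open>
  An almost shortest path is almost a geodesic: its points nearly give equality in the triangle
  inequality.
\<close>

lemma length_space_almost_geodesic:
  fixes x y :: "'a::metric_space"
  assumes "length_space (UNIV :: 'a set)" "dist x y < r"
  obtains g where "path g" "g 0 = x" "g 1 = y" "\<And>t. t \<in> {0..1} \<Longrightarrow> dist x (g t) + dist (g t) y < r"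
proof -
  obtain g where g: "path g" "g 0 = x" "g 1 = y" "curve_length g < ennreal r"
    using length_space_short_path[OF assms] by blast
  have "dist x (g t) + dist (g t) y < r" if "t \<in> {0..1}" for t
  proof -
    have "ennreal (dist x (g t) + dist (g t) y) < ennreal r"
      using dist_add_dist_le_curve_length[OF that, of g] g by (metis order_le_less_trans)
    then show ?thesis
      by (simp add: ennreal_less_iff del: ennreal_plus)
  qed
  then show ?thesis using that g by blast
qed

lemma length_space_connected_ball:
  fixes x :: "'a::metric_space"
  assumes "length_space (UNIV :: 'a set)"
  shows "connected (ball x r)"
proof (rule path_connected_imp_connected)
  show "path_connected (ball x r)"
  proof (cases "r > 0")
    case True
    have "path_component (ball x r) x y" if y: "y \<in> ball x r" for y
    proof -
      obtain g where g: "path g" "g 0 = x" "g 1 = y" "\<And>t. t \<in> {0..1} \<Longrightarrow> dist x (g t) + dist (g t) y < r"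
        using y unfolding mem_ball by (rule length_space_almost_geodesic[OF assms]) (rule that)
      have "g t \<in> ball x r" if "t \<in> {0..1}" for t
        using g(4)[OF that] zero_le_dist[of "g t" y] unfolding mem_ball by linarith
      then show ?thesis
        unfolding path_component_def using g by (auto simp: path_image_def pathstart_def pathfinish_def)
    qed
    then show ?thesis
      unfolding path_connected_component
      by (meson path_component_sym path_component_trans)
  qed (simp add: ball_empty)
qed

text \<open>
  This is the Hopf--Rinow theorem in the form needed for coverings of compact spaces. If the closed
  ball of radius \<open>r\<close> is compact, it is covered by finitely many balls of radius \<open>\<rho> / 4\<close>. Following
  an almost shortest path back to \<open>x\<close>, every point of the ball of radius \<open>r + \<rho> / 4\<close> is seen to be
  near the ball of radius \<open>r\<close>, and the larger ball is covered by finitely many compact balls of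
  radius \<open>\<rho>\<close>.
\<close>

lemma length_space_proper:
  fixes x :: "'a::metric_space"
  assumes len: "length_space (UNIV :: 'a set)" and \<rho>: "\<rho> > 0"
    and unif: "\<And>x::'a. compact (cball x \<rho>)"
  shows "compact (cball x r)"
proof -
  have ext: "compact (cball x (r + \<rho> / 4))" if c: "compact (cball x r)" for r
  proof -
    obtain C where C: "finite C" "cball x r \<subseteq> (\<Union>c\<in>C. ball c (\<rho>/4))"
      using compactE_image[OF c, of UNIV "\<lambda>c. ball c (\<rho>/4)"] \<rho> by (metis UNIV_I UN_I centre_in_ball open_ball subsetI zero_less_divide_iff zero_less_numeral)
    have "y \<in> (\<Union>c\<in>insert x C. cball c \<rho>)" if y: "y \<in> cball x (r + \<rho> / 4)" for y
    proof (cases "dist x y \<le> r \<or> r < 0")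
      case True
      then show ?thesis
      proof
        assume "dist x y \<le> r"
        then obtain c where "c \<in> C" "dist c y < \<rho>/4" using C by (auto simp: subset_iff)
        then show ?thesis using \<rho> by (intro UN_I[of c]) auto
      next
        assume "r < 0"
        then have "y \<in> cball x \<rho>" using y \<rho> by auto
        then show ?thesis by blast
      qed
    next
      case False
      then have ry: "r < dist x y" "0 \<le> r" by auto
      obtain g where g: "path g" "g 0 = x" "g 1 = y"
          "\<And>t. t \<in> {0..1} \<Longrightarrow> dist x (g t) + dist (g t) y < dist x y + \<rho>/4"
        using length_space_almost_geodesic[OF len, of x y "dist x y + \<rho>/4"] \<rho> by auto
      have "continuous_on {0..1} (\<lambda>t. dist x (g t))"
        using g(1) unfolding path_def by (intro continuous_intros)
      then obtain t where t: "0 \<le> t" "t \<le> 1" "dist x (g t) = r"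
        using IVT'[of "\<lambda>t. dist x (g t)" 0 r 1] ry g by auto
      then have "g t \<in> cball x r" by simp
      then obtain c where "c \<in> C" "dist c (g t) < \<rho>/4" using C by (auto simp: subset_iff)
      moreover have "dist (g t) y < \<rho>/2"
        using g(4)[of t] t y by auto
      ultimately have "dist c y \<le> \<rho>"
        using dist_triangle[of c y "g t"] \<rho> by linarith
      then show ?thesis using \<open>c \<in> C\<close> by auto
    qed
    then have "cball x (r + \<rho>/4) = cball x (r + \<rho>/4) \<inter> (\<Union>c\<in>insert x C. cball c \<rho>)"
      by blast
    moreover have "compact (\<dots>)"
      using C(1) by (intro closed_Int_compact compact_UN finite.insertI unif closed_cball)
    ultimately show ?thesis by simp
  qed
  have "compact (cball x (real n * (\<rho>/4)))" for n
  proof (induction n)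
    case (Suc n)
    have "real (Suc n) * (\<rho>/4) = real n * (\<rho>/4) + \<rho>/4" by (simp add: algebra_simps add_divide_distrib)
    then show ?case using ext[OF Suc] by metis
  qed simp
  moreover obtain n where n: "r \<le> real n * (\<rho>/4)"
    using \<rho> by (metis ex_less_of_nat_mult less_le_not_le linorder_le_cases zero_less_divide_iff zero_less_numeral)
  ultimately have "compact (cball x r \<inter> cball x (real n * (\<rho>/4)))"
    by (intro closed_Int_compact closed_cball)
  moreover have "cball x r \<inter> cball x (real n * (\<rho>/4)) = cball x r" using n by auto
  ultimately show ?thesis by simp
qed

section \<open>Coverings by local isometries\<close>

lemma local_isometry_nonexpanding:
  fixes p :: "'b::metric_space \<Rightarrow> 'a::metric_space"
  assumes "length_space (UNIV :: 'b set)" "local_isometry p"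
  shows "dist (p x) (p y) \<le> dist x y"
proof (rule field_le_epsilon)
  fix e :: real assume "e > 0"
  then obtain g where g: "path g" "g 0 = x" "g 1 = y" "curve_length g < ennreal (dist x y + e)"
    using length_space_short_path[OF assms(1), of x y "dist x y + e"] by auto
  have "ennreal (dist ((p \<circ> g) 0) ((p \<circ> g) 1)) \<le> curve_length g"
  proof (rule dist_le_curve_length_of_local)
    fix t :: real assume t: "t \<in> {0..1}"
    obtain e where e: "e > 0" "\<forall>y\<in>ball (g t) e. \<forall>z\<in>ball (g t) e. dist (p y) (p z) = dist y z"
      using assms(2) unfolding local_isometry_def by metis
    obtain d where "d > 0" "\<forall>u\<in>{0..1}. dist u t < d \<longrightarrow> dist (g u) (g t) < e"
      using g(1) t e(1) unfolding path_def continuous_on_iff by metis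
    then show "\<exists>d>0. \<forall>u\<in>{0..1}. \<forall>v\<in>{0..1}. \<bar>u - t\<bar> < d \<longrightarrow> \<bar>v - t\<bar> < d \<longrightarrow>
        dist ((p \<circ> g) u) ((p \<circ> g) v) \<le> dist (g u) (g v)"
      using e(2) by (intro exI[of _ d]) (auto simp: dist_real_def dist_commute)
  qed
  then have "ennreal (dist (p x) (p y)) < ennreal (dist x y + e)"
    using g by (metis comp_apply order_le_less_trans)
  then show "dist (p x) (p y) \<le> dist x y + e"
    by (simp add: ennreal_less_iff)
qed


text \<open>
  A Lebesgue number \<open>\<epsilon>\<close> for the evenly covered sets works at all points at once: a path from \<open>x\<close> of
  length less than \<open>\<epsilon>\<close> projects into a ball of radius \<open>\<epsilon>\<close>, hence into one evenly covered set, and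
  cannot leave the sheet in which it starts.
\<close>

lemma covering_local_section:
  fixes p :: "'b::metric_space \<Rightarrow> 'a::metric_space"
  assumes S: "compact (UNIV :: 'a set)" and len: "length_space (UNIV :: 'b set)"
    and cov: "covering_space UNIV p UNIV" and loc: "local_isometry p"
  shows "\<exists>\<epsilon>>0. \<forall>x. \<exists>q. continuous_on (ball (p x) \<epsilon>) q \<and> (\<forall>a\<in>ball (p x) \<epsilon>. p (q a) = a) \<and>
        (\<forall>y\<in>ball x \<epsilon>. q (p y) = y)"
proof -
  define E where "E T \<longleftrightarrow> open T \<and> (\<exists>v. \<Union>v = p -` T \<and> (\<forall>u\<in>v. open u) \<and> pairwise disjnt v \<and>
                     (\<forall>u\<in>v. \<exists>q. homeomorphism u T p q))" for T
  have "\<exists>T. a \<in> T \<and> E T" for a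
    using cov unfolding covering_space_def E_def by simp
  then have "UNIV \<subseteq> \<Union>(Collect E)" by auto
  then obtain \<epsilon> where \<epsilon>: "\<epsilon> > 0" "\<And>a. a \<in> UNIV \<Longrightarrow> \<exists>T\<in>Collect E. ball a \<epsilon> \<subseteq> T"
    by (rule Heine_Borel_lemma[OF S]) (auto simp: E_def)
  have "\<exists>q. continuous_on (ball (p x) \<epsilon>) q \<and> (\<forall>a\<in>ball (p x) \<epsilon>. p (q a) = a) \<and>
        (\<forall>y\<in>ball x \<epsilon>. q (p y) = y)" for x
  proof -
    obtain T where T: "ball (p x) \<epsilon> \<subseteq> T" "E T" using \<epsilon>(2)[of "p x", OF UNIV_I] by auto
    obtain v where v: "\<Union>v = p -` T" "\<And>u. u \<in> v \<Longrightarrow> open u" "pairwise disjnt v"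
      and q: "\<And>u. u \<in> v \<Longrightarrow> \<exists>q. homeomorphism u T p q"
      using T(2) unfolding E_def by auto
    note T = T(1)
    have "p x \<in> T" using T \<epsilon>(1) by auto
    then have "x \<in> \<Union>v" using v(1) by simp
    then obtain V where V: "V \<in> v" "x \<in> V" by (rule UnionE)
    obtain q where q: "homeomorphism V T p q" using q[OF V(1)] by (rule exE)
    have sub: "y \<in> V" if y: "y \<in> ball x \<epsilon>" for y
    proof -
      obtain g where g: "path g" "g 0 = x" "g 1 = y" "\<And>t. t \<in> {0..1} \<Longrightarrow> dist x (g t) + dist (g t) y < \<epsilon>"
        using length_space_almost_geodesic[OF len, of x y \<epsilon>] y \<epsilon>(1) by auto
      have "p (g t) \<in> T" if "t \<in> {0..1}" for t
      proof -
        have "dist (p x) (p (g t)) < \<epsilon>"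
          using local_isometry_nonexpanding[OF len loc, of x "g t"] g(4)[OF that] zero_le_dist[of "g t" y]
          by linarith
        then show ?thesis using T by auto
      qed
      then have img: "path_image g \<subseteq> V \<union> \<Union>(v - {V})"
        using v(1) V(1) by (auto simp: path_image_def)
      have "open V" "open (\<Union>(v - {V}))" "V \<inter> \<Union>(v - {V}) = {}"
        using v(2,3) V(1) by (auto simp: pairwise_def disjnt_def)
      moreover have "connected (path_image g)" using g(1) by (rule connected_path_image)
      moreover have "x \<in> path_image g" "y \<in> path_image g"
        using g(2,3) by (auto simp: path_image_def)
      ultimately show "y \<in> V"
        using connectedD[of "path_image g" V "\<Union>(v - {V})"] img V(2) by blast
    qed
    have "continuous_on (ball (p x) \<epsilon>) q"
      using q T by (meson homeomorphism_def continuous_on_subset)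
    moreover have "\<forall>a\<in>ball (p x) \<epsilon>. p (q a) = a"
      using q T by (auto simp: homeomorphism_def)
    moreover have "\<forall>y\<in>ball x \<epsilon>. q (p y) = y"
      using q sub by (auto simp: homeomorphism_def)
    ultimately show ?thesis by blast
  qed
  then show ?thesis using \<epsilon>(1) by auto
qed

text \<open>
  The local sections map compact balls of the base onto sets that contain small balls of the total
  space, with a radius that does not depend on the centre. So small balls are uniformly compact,
  which implies that all balls are.
\<close>

lemma covering_proper:
  fixes p :: "'b::metric_space \<Rightarrow> 'a::metric_space"
  assumes S: "compact (UNIV :: 'a set)" and len: "length_space (UNIV :: 'b set)"
    and cov: "covering_space UNIV p UNIV" and loc: "local_isometry p"
  shows "compact (cball (x::'b) r)"
proof -
  obtain \<epsilon> where \<epsilon>: "\<epsilon> > 0"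
    "\<And>x. \<exists>q. continuous_on (ball (p x) \<epsilon>) q \<and> (\<forall>a\<in>ball (p x) \<epsilon>. p (q a) = a) \<and>
        (\<forall>y\<in>ball x \<epsilon>. q (p y) = y)"
    using covering_local_section[OF assms] by auto
  have "compact (cball x (\<epsilon>/2))" for x :: 'b
  proof -
    obtain q where q: "continuous_on (ball (p x) \<epsilon>) q" "\<forall>y\<in>ball x \<epsilon>. q (p y) = y"
      using \<epsilon>(2) by blast
    have "cball x (\<epsilon>/2) \<subseteq> q ` cball (p x) (\<epsilon>/2)"
    proof
      fix y assume y: "y \<in> cball x (\<epsilon>/2)"
      then have "q (p y) = y" using q(2) \<epsilon>(1) by auto
      moreover have "p y \<in> cball (p x) (\<epsilon>/2)"
        using y local_isometry_nonexpanding[OF len loc, of x y] by auto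
      ultimately show "y \<in> q ` cball (p x) (\<epsilon>/2)" by force
    qed
    moreover have "compact (q ` cball (p x) (\<epsilon>/2))"
    proof (rule compact_continuous_image)
      show "continuous_on (cball (p x) (\<epsilon>/2)) q"
        using \<epsilon>(1) by (intro continuous_on_subset[OF q(1)]) auto
      have "compact (UNIV \<inter> cball (p x) (\<epsilon>/2))"
        using S by (intro compact_Int_closed closed_cball)
      then show "compact (cball (p x) (\<epsilon>/2))" by simp
    qed
    ultimately show ?thesis
      using closed_Int_compact[OF closed_cball] by (metis inf.absorb_iff1)
  qed
  then show ?thesis using length_space_proper[OF len, of "\<epsilon>/2"] \<epsilon>(1) by simp
qed

text \<open>
  Nearby points of the base lift to nearby points, since a local section does not increase the
  length of a short path. A point at an arbitrary distance is reached in boundedly many such steps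
  along an almost shortest path, because the base is bounded.
\<close>

lemma covering_fibre_dense:
  fixes p :: "'b::metric_space \<Rightarrow> 'a::metric_space"
  assumes S: "compact (UNIV :: 'a set)" and lenS: "length_space (UNIV :: 'a set)"
    and len: "length_space (UNIV :: 'b set)"
    and cov: "covering_space UNIV p UNIV" and loc: "local_isometry p"
  obtains R where "\<And>w s. \<exists>z. p z = s \<and> dist w z < R"
proof -
  obtain \<epsilon> where \<epsilon>: "\<epsilon> > 0"
    "\<And>x. \<exists>q. continuous_on (ball (p x) \<epsilon>) q \<and> (\<forall>a\<in>ball (p x) \<epsilon>. p (q a) = a) \<and>
        (\<forall>y\<in>ball x \<epsilon>. q (p y) = y)"
    using covering_local_section[OF S len cov loc] by auto
  have near: "\<exists>z. p z = s \<and> dist w z < \<epsilon>" if d: "dist (p w) s < \<epsilon>" for w s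
  proof -
    obtain g where g: "path g" "g 0 = p w" "g 1 = s" "curve_length g < ennreal \<epsilon>"
      using length_space_short_path[OF lenS d] by blast
    obtain q where q: "continuous_on (ball (p w) \<epsilon>) q" "\<forall>a\<in>ball (p w) \<epsilon>. p (q a) = a" "q (p w) = w"
      using \<epsilon>(2)[of w] \<epsilon>(1) by auto
    have gb: "g t \<in> ball (p w) \<epsilon>" if "t \<in> {0..1}" for t
    proof -
      have "ennreal (dist (p w) (g t) + dist (g t) s) < ennreal \<epsilon>"
        using dist_add_dist_le_curve_length[OF that, of g] g by (metis order_le_less_trans)
      then have "dist (p w) (g t) + dist (g t) s < \<epsilon>"
        by (simp add: ennreal_less_iff del: ennreal_plus)
      then show ?thesis
        using zero_le_dist[of "g t" s] unfolding mem_ball by linarith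
    qed
    have cont: "continuous_on {0..1} (\<lambda>t. q (g t))"
      using g(1) gb unfolding path_def by (intro continuous_on_compose2[OF q(1)]) auto
    have "ennreal (dist (q (g 0)) (q (g 1))) \<le> curve_length g"
    proof (rule dist_le_curve_length_of_local)
      fix t :: real assume t: "t \<in> {0..1}"
      obtain e where e: "e > 0" "\<forall>y\<in>ball (q (g t)) e. \<forall>z\<in>ball (q (g t)) e. dist (p y) (p z) = dist y z"
        using loc unfolding local_isometry_def by metis
      obtain d where d: "d > 0" "\<forall>u\<in>{0..1}. dist u t < d \<longrightarrow> dist (q (g u)) (q (g t)) < e"
        using cont t e(1) unfolding continuous_on_iff by metis
      have "dist (q (g u)) (q (g v)) \<le> dist (g u) (g v)"
        if uv: "u \<in> {0..1}" "v \<in> {0..1}" "\<bar>u - t\<bar> < d" "\<bar>v - t\<bar> < d" for u v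
      proof -
        have "q (g u) \<in> ball (q (g t)) e" "q (g v) \<in> ball (q (g t)) e"
          using d(2) uv by (auto simp: dist_real_def dist_commute[of "q (g t)"])
        then have "dist (p (q (g u))) (p (q (g v))) = dist (q (g u)) (q (g v))"
          using e(2) by blast
        then show ?thesis using q(2) gb[OF uv(1)] gb[OF uv(2)] by simp
      qed
      then show "\<exists>d>0. \<forall>u\<in>{0..1}. \<forall>v\<in>{0..1}. \<bar>u - t\<bar> < d \<longrightarrow> \<bar>v - t\<bar> < d \<longrightarrow>
          dist (q (g u)) (q (g v)) \<le> dist (g u) (g v)"
        using d(1) by blast
    qed
    then have "dist w (q s) < \<epsilon>"
      using g q(3) by (metis ennreal_less_iff order_le_less_trans zero_le_dist)
    then show ?thesis using q(2) d by (intro exI[of _ "q s"]) auto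
  qed
  have step: "\<exists>z. p z = s \<and> dist w z < real (Suc n) * \<epsilon>" if "dist (p w) s < real (Suc n) * (\<epsilon>/2)" for w s n
    using that
  proof (induction n arbitrary: s)
    case 0
    then show ?case using near[of w s] \<epsilon>(1) by auto
  next
    case (Suc n)
    show ?case
    proof (cases "dist (p w) s < real (Suc n) * (\<epsilon>/2)")
      case True
      then obtain z where "p z = s" "dist w z < real (Suc n) * \<epsilon>" using Suc.IH by blast
      moreover have "real (Suc n) * \<epsilon> \<le> real (Suc (Suc n)) * \<epsilon>" using \<epsilon>(1) by simp
      ultimately show ?thesis by (intro exI[of _ z]) linarith
    next
      case False
      \<comment> \<open>A distance that the previous steps reach and from which less than \<open>\<epsilon>\<close> remains.\<close>
      define c where "c = (real n + 1/2) * (\<epsilon>/2)"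
      have c: "0 \<le> c" "c < real (Suc n) * (\<epsilon>/2)" "real (Suc (Suc n)) * (\<epsilon>/2) - c < \<epsilon>"
        using \<epsilon>(1) by (auto simp: c_def algebra_simps)
      obtain g where g: "path g" "g 0 = p w" "g 1 = s"
          "\<And>t. t \<in> {0..1} \<Longrightarrow> dist (p w) (g t) + dist (g t) s < real (Suc (Suc n)) * (\<epsilon>/2)"
        using length_space_almost_geodesic[OF lenS Suc.prems] by blast
      have "continuous_on {0..1} (\<lambda>t. dist (p w) (g t))"
        using g(1) unfolding path_def by (intro continuous_intros)
      then obtain t where t: "0 \<le> t" "t \<le> 1" "dist (p w) (g t) = c"
        using IVT'[of "\<lambda>t. dist (p w) (g t)" 0 c 1] c False g by auto
      then obtain z where z: "p z = g t" "dist w z < real (Suc n) * \<epsilon>"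
        using Suc.IH[of "g t"] c by auto
      have "dist (p z) s < \<epsilon>"
        using g(4)[of t] t c z by auto
      then obtain z' where z': "p z' = s" "dist z z' < \<epsilon>" using near by blast
      then have "dist w z' < real (Suc (Suc n)) * \<epsilon>"
        using z(2) dist_triangle[of w z' z] by (simp add: algebra_simps)
      then show ?thesis using z' by blast
    qed
  qed
  obtain R where R: "\<And>a b. dist (a::'a) b \<le> R"
    using compact_imp_bounded[OF S] unfolding bounded_two_points by auto
  obtain n where "R < real n * (\<epsilon>/2)"
    using \<epsilon>(1) by (metis ex_less_of_nat_mult zero_less_divide_iff zero_less_numeral)
  then have "R < real (Suc n) * (\<epsilon>/2)"
    using \<epsilon>(1) by (simp add: algebra_simps)
  then have "\<exists>z. p z = s \<and> dist w z < real (Suc n) * \<epsilon>" for w s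
    using step[of w s n] R[of "p w" s] by (meson order_le_less_trans)
  then show ?thesis using that by blast
qed

lemma fibre_finite_cball:
  fixes p :: "'b::metric_space \<Rightarrow> 'a::metric_space"
  assumes proper: "\<And>x r. compact (cball (x::'b) r)" and loc: "local_isometry p" and P: "finite P"
  shows "finite (p -` P \<inter> cball x r)"
proof -
  have inj: "\<exists>e>0. finite (p -` P \<inter> ball y e)" for y
  proof -
    obtain e where e: "e > 0" "\<forall>u\<in>ball y e. \<forall>v\<in>ball y e. dist (p u) (p v) = dist u v"
      using loc unfolding local_isometry_def by metis
    have "inj_on p (ball y e)"
      by (rule inj_onI) (metis e(2) dist_eq_0_iff)
    then have "finite (p -` P \<inter> ball y e)"
      using P by (intro finite_vimage_IntI)
    then show ?thesis using e(1) by blast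
  qed
  then have "\<forall>y. \<exists>e>0. finite (p -` P \<inter> ball y e)" by blast
  then obtain e where e: "\<And>y. e y > 0" "\<And>y. finite (p -` P \<inter> ball y (e y))"
    unfolding choice_iff by blast
  have "y \<in> (\<Union>c. ball c (e c))" for y
    using e(1)[of y] by (intro UN_I[of y]) simp_all
  then have "cball x r \<subseteq> (\<Union>c. ball c (e c))" by blast
  then obtain C where C: "finite C" "cball x r \<subseteq> (\<Union>c\<in>C. ball c (e c))"
    by (rule compactE_image[OF proper open_ball])
  have "p -` P \<inter> cball x r \<subseteq> (\<Union>c\<in>C. p -` P \<inter> ball c (e c))" using C(2) by blast
  moreover have "finite (\<Union>c\<in>C. p -` P \<inter> ball c (e c))" using C(1) e(2) by blast
  ultimately show ?thesis by (rule finite_subset)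
qed

section \<open>Regular points and cone points\<close>

lemma local_isometry_balls:
  assumes "local_isometry p"
  obtains e where "e > 0" "\<And>r. r \<le> e \<Longrightarrow> p ` ball x r = ball (p x) r"
    "\<And>u v. u \<in> ball x e \<Longrightarrow> v \<in> ball x e \<Longrightarrow> dist (p u) (p v) = dist u v"
proof -
  obtain e where e: "e > 0" "p ` ball x e = ball (p x) e"
    "\<And>u v. u \<in> ball x e \<Longrightarrow> v \<in> ball x e \<Longrightarrow> dist (p u) (p v) = dist u v"
    using assms unfolding local_isometry_def by metis
  have "p ` ball x r = ball (p x) r" if r: "r \<le> e" for r
  proof (intro equalityI subsetI)
    fix b assume "b \<in> p ` ball x r"
    then show "b \<in> ball (p x) r" using e(1,3) r by (auto simp: subset_iff)
  next
    fix b assume b: "b \<in> ball (p x) r"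
    then have "b \<in> p ` ball x e" using r e(2) by auto
    then obtain u where u: "u \<in> ball x e" "b = p u" by blast
    then have "dist x u < r" using b e(1) e(3)[of x u] by simp
    then show "b \<in> p ` ball x r" using u by auto
  qed
  then show ?thesis using that e by blast
qed

text \<open>
  The chart of a regular point is recentred, and restricted to balls it can be shrunk at will.
\<close>

lemma euclidean_at_balls:
  fixes y :: "'a::metric_space"
  assumes "euclidean_at y"
  obtains e and f :: "'a \<Rightarrow> real^2" where "e > 0" "f y = 0" "\<And>r. r \<le> e \<Longrightarrow> f ` ball y r = ball 0 r"
    "\<And>u v. u \<in> ball y e \<Longrightarrow> v \<in> ball y e \<Longrightarrow> dist (f u) (f v) = dist u v"
proof -
  obtain U d and f :: "'a \<Rightarrow> real^2" where U: "open U" "y \<in> U" "d > 0" "f ` U = ball 0 d"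
    "\<And>u v. u \<in> U \<Longrightarrow> v \<in> U \<Longrightarrow> dist (f u) (f v) = dist u v"
    using assms unfolding euclidean_at_def by (elim exE conjE, intro that) (assumption | blast)+
  obtain e1 where e1: "e1 > 0" "ball y e1 \<subseteq> U" using U(1,2) open_contains_ball by blast
  obtain e2 where e2: "e2 > 0" "ball (f y) e2 \<subseteq> ball 0 d"
    using U(2,4) by (metis image_eqI open_ball open_contains_ball)
  define e where "e = min e1 e2"
  define f' where "f' u = f u - f y" for u
  have "f' ` ball y r = ball 0 r" if r: "r \<le> e" for r
  proof (intro equalityI subsetI)
    fix w assume "w \<in> f' ` ball y r"
    then obtain u where u: "w = f' u" "dist y u < r" by auto
    then have "u \<in> U" using e1 r by (auto simp: e_def subset_iff)
    then have "dist (f y) (f u) < r" using U(2,5) u(2) by auto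
    then show "w \<in> ball 0 r" using u(1) by (simp add: f'_def dist_norm norm_minus_commute)
  next
    fix w :: "real^2" assume w: "w \<in> ball 0 r"
    then have "w + f y \<in> ball (f y) e2" using r by (simp add: e_def dist_norm)
    then obtain u where u: "u \<in> U" "f u = w + f y" using e2 U(4) by (metis imageE subsetD)
    then have "dist y u < r" using U(5)[of y u] U(2) w by (simp add: dist_norm)
    then show "w \<in> f' ` ball y r" using u by (auto simp: f'_def intro!: image_eqI[of _ _ u])
  qed
  moreover have "dist (f' u) (f' v) = dist u v" if "u \<in> ball y e" "v \<in> ball y e" for u v
  proof -
    have "u \<in> U" "v \<in> U" using that e1 by (auto simp: e_def subset_iff)
    then show ?thesis using U(5) by (simp add: f'_def dist_norm)
  qed
  moreover have "f' y = 0" "e > 0" using e1 e2 by (auto simp: f'_def e_def)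
  ultimately show ?thesis using that by blast
qed

lemma euclidean_at_lift:
  assumes "local_isometry p" "euclidean_at (p x)"
  shows "euclidean_at x"
proof -
  obtain e where e: "e > 0" "\<And>r. r \<le> e \<Longrightarrow> p ` ball x r = ball (p x) r"
    "\<And>u v. u \<in> ball x e \<Longrightarrow> v \<in> ball x e \<Longrightarrow> dist (p u) (p v) = dist u v"
    using local_isometry_balls[OF assms(1)] by blast
  obtain d f where d: "d > 0" "f (p x) = (0::real^2)" "\<And>r. r \<le> d \<Longrightarrow> f ` ball (p x) r = ball 0 r"
    "\<And>u v. u \<in> ball (p x) d \<Longrightarrow> v \<in> ball (p x) d \<Longrightarrow> dist (f u) (f v) = dist u v"
    using euclidean_at_balls[OF assms(2)] by blast
  define r where "r = min d e"
  have r: "r > 0" "r \<le> d" "r \<le> e" using e d by (auto simp: r_def)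
  have "(f \<circ> p) ` ball x r = ball 0 r"
    by (simp only: image_comp[symmetric] e(2)[OF r(3)] d(3)[OF r(2)])
  moreover have "dist ((f \<circ> p) u) ((f \<circ> p) v) = dist u v" if "u \<in> ball x r" "v \<in> ball x r" for u v
  proof -
    have "p u \<in> p ` ball x r" "p v \<in> p ` ball x r" using that by blast+
    then have "p u \<in> ball (p x) d" "p v \<in> ball (p x) d" using e(2)[OF r(3)] r by auto
    then show ?thesis using d(4) e(3) that r by auto
  qed
  ultimately show ?thesis
    unfolding euclidean_at_def using r(1) by (intro exI[of _ "ball x r"] exI[of _ r] exI[of _ "f \<circ> p"]) auto
qed

lemma cone_dist_apex: "q \<in> cone \<theta> \<Longrightarrow> cone_dist \<theta> q (0, 0) = fst q"
  by (auto simp: cone_def cone_dist_def)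

lemma conical_at_balls:
  fixes z :: "'a::metric_space"
  assumes "conical_at \<theta> z"
  obtains e and f :: "'a \<Rightarrow> real \<times> real" where "e > 0" "f z = (0, 0)"
    "\<And>r. r \<le> e \<Longrightarrow> f ` ball z r = {q \<in> cone \<theta>. fst q < r}"
    "\<And>u v. u \<in> ball z e \<Longrightarrow> v \<in> ball z e \<Longrightarrow> cone_dist \<theta> (f u) (f v) = dist u v"
proof -
  obtain U d f where U: "open U" "z \<in> U" "d > 0" "f ` U = {q \<in> cone \<theta>. fst q < d}" "f z = (0, 0)"
    "\<And>u v. u \<in> U \<Longrightarrow> v \<in> U \<Longrightarrow> cone_dist \<theta> (f u) (f v) = dist u v"
    using assms unfolding conical_at_def by (elim exE conjE, intro that) (assumption | blast)+
  obtain e1 where e1: "e1 > 0" "ball z e1 \<subseteq> U" using U(1,2) open_contains_ball by blast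
  define e where "e = min e1 d"
  have fst: "fst (f u) = dist z u" "f u \<in> cone \<theta>" if "u \<in> U" for u
  proof -
    show "f u \<in> cone \<theta>" using U(4) that by blast
    then show "fst (f u) = dist z u"
      using U(6)[OF that U(2)] U(5) cone_dist_apex by (metis dist_commute)
  qed
  have "f ` ball z r = {q \<in> cone \<theta>. fst q < r}" if r: "r \<le> e" for r
  proof (intro equalityI subsetI)
    fix q assume "q \<in> f ` ball z r"
    then obtain u where u: "q = f u" "dist z u < r" by auto
    then have "u \<in> U" using e1 r by (auto simp: e_def subset_iff)
    then show "q \<in> {q \<in> cone \<theta>. fst q < r}" using fst u by auto
  next
    fix q assume q: "q \<in> {q \<in> cone \<theta>. fst q < r}"
    then have "q \<in> f ` U" using U(4) r by (auto simp: e_def)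
    then obtain u where "u \<in> U" "q = f u" by blast
    then show "q \<in> f ` ball z r" using fst q by auto
  qed
  moreover have "cone_dist \<theta> (f u) (f v) = dist u v" if "u \<in> ball z e" "v \<in> ball z e" for u v
  proof -
    have "u \<in> U" "v \<in> U" using that e1 by (auto simp: e_def subset_iff)
    then show ?thesis using U(6) by blast
  qed
  moreover have "e > 0" using e1 U by (auto simp: e_def)
  ultimately show ?thesis using that U(5) by blast
qed

lemma conical_at_lift:
  assumes "local_isometry p" "conical_at \<theta> (p x)"
  shows "conical_at \<theta> x"
proof -
  obtain e where e: "e > 0" "\<And>r. r \<le> e \<Longrightarrow> p ` ball x r = ball (p x) r"
    "\<And>u v. u \<in> ball x e \<Longrightarrow> v \<in> ball x e \<Longrightarrow> dist (p u) (p v) = dist u v"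
    using local_isometry_balls[OF assms(1)] by blast
  obtain d f where d: "d > 0" "f (p x) = (0, 0)" "\<And>r. r \<le> d \<Longrightarrow> f ` ball (p x) r = {q \<in> cone \<theta>. fst q < r}"
    "\<And>u v. u \<in> ball (p x) d \<Longrightarrow> v \<in> ball (p x) d \<Longrightarrow> cone_dist \<theta> (f u) (f v) = dist u v"
    using conical_at_balls[OF assms(2)] by blast
  define r where "r = min d e"
  have r: "r > 0" "r \<le> d" "r \<le> e" using e d by (auto simp: r_def)
  have "(f \<circ> p) ` ball x r = {q \<in> cone \<theta>. fst q < r}"
    by (simp only: image_comp[symmetric] e(2)[OF r(3)] d(3)[OF r(2)])
  moreover have "cone_dist \<theta> ((f \<circ> p) u) ((f \<circ> p) v) = dist u v" if "u \<in> ball x r" "v \<in> ball x r" for u v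
  proof -
    have "p u \<in> p ` ball x r" "p v \<in> p ` ball x r" using that by blast+
    then have "p u \<in> ball (p x) d" "p v \<in> ball (p x) d" using e(2)[OF r(3)] r by auto
    then show ?thesis using d(4) e(3) that r by auto
  qed
  ultimately show ?thesis
    unfolding conical_at_def using r(1) d(2)
    by (intro exI[of _ "ball x r"] exI[of _ r] exI[of _ "f \<circ> p"]) auto
qed

text \<open>
  In polar coordinates the punctured ball is the continuous image of the rectangle
  \<open>{0<..<r} \<times> {0..<\<theta>}\<close>. The half-open range of angles already contains every
  direction.
\<close>

lemma conical_at_punctured_ball_connected:
  fixes z :: "'a::metric_space"
  assumes "conical_at \<theta> z" "0 < \<theta>"
  obtains e where "e > 0" "\<And>r. r \<le> e \<Longrightarrow> connected (ball z r - {z})"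
proof -
  obtain e f where e: "e > 0" "f z = (0, 0)"
    "\<And>r. r \<le> e \<Longrightarrow> f ` ball z r = {q \<in> cone \<theta>. fst q < r}"
    and iso: "\<And>u v. u \<in> ball z e \<Longrightarrow> v \<in> ball z e \<Longrightarrow> cone_dist \<theta> (f u) (f v) = dist u v"
    using conical_at_balls[OF assms(1)] by blast
  have self: "cone_dist \<theta> q q = 0" for q
    using assms(2) by (auto simp: cone_dist_def cone_angle_dist_def power2_eq_square split: prod.splits)
  have inj: "inj_on f (ball z e)"
  proof (rule inj_onI)
    fix u v assume "u \<in> ball z e" "v \<in> ball z e" "f u = f v"
    then show "u = v" using iso[of u v] self by simp
  qed
  have "connected (ball z r - {z})" if r: "r \<le> e" for r
  proof -
    define A where "A = {0<..<r} \<times> {0..<\<theta>}"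
    define G where "G = inv_into (ball z r) f"
    have A: "A \<subseteq> f ` ball z r" using e(3)[OF r] by (auto simp: A_def cone_def)
    have G: "G q \<in> ball z r" "f (G q) = q" if "q \<in> A" for q
      using that A unfolding G_def by (blast intro: inv_into_into f_inv_into_f)+
    have dG: "dist (G q) (G q') = cone_dist \<theta> q q'" if "q \<in> A" "q' \<in> A" for q q'
    proof -
      have "G q \<in> ball z e" "G q' \<in> ball z e" using G[OF that(1)] G[OF that(2)] r by auto
      then show ?thesis using iso G that by metis
    qed
    have "continuous_on A G"
      unfolding continuous_on_def
    proof
      fix q assume q: "q \<in> A"
      have "continuous_on A (\<lambda>q'. cone_dist \<theta> q' q)"
        unfolding cone_dist_def case_prod_beta cone_angle_dist_def by (intro continuous_intros)
      then have "((\<lambda>q'. cone_dist \<theta> q' q) \<longlongrightarrow> 0) (at q within A)"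
        using q self unfolding continuous_on_def by metis
      then have "((\<lambda>q'. dist (G q') (G q)) \<longlongrightarrow> 0) (at q within A)"
        by (rule Lim_transform_within[where d = 1]) (use q dG in auto)
      then show "(G \<longlongrightarrow> G q) (at q within A)"
        by (rule tendsto_dist_iff[THEN iffD2])
    qed
    moreover have "connected A"
      unfolding A_def by (intro convex_connected convex_Times) auto
    ultimately have "connected (G ` A)" by (rule connected_continuous_image)
    moreover have "G ` A = ball z r - {z}"
    proof (intro equalityI subsetI)
      fix u assume "u \<in> G ` A"
      then obtain q where q: "q \<in> A" "u = G q" by blast
      have "fst q > 0" using q(1) by (auto simp: A_def)
      then have "f u \<noteq> f z" using G(2)[OF q(1)] q(2) e(2) by auto
      then show "u \<in> ball z r - {z}" using G(1)[OF q(1)] q(2) by auto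
    next
      fix u assume u: "u \<in> ball z r - {z}"
      then have "f u \<noteq> f z" using inj r e(1) by (auto simp: inj_on_def)
      moreover have "f u \<in> {q \<in> cone \<theta>. fst q < r}" using e(3)[OF r] u by blast
      ultimately have "f u \<in> A" using e(2) by (auto simp: cone_def A_def)
      moreover have "G (f u) = u"
        unfolding G_def using u r by (intro inv_into_f_f inj_on_subset[OF inj]) auto
      ultimately show "u \<in> G ` A" by force
    qed
    ultimately show ?thesis by simp
  qed
  then show ?thesis using that e(1) by blast
qed

section \<open>Geodesic rays and the boundary\<close>

lemma geodesic_ray_dist: "geodesic_ray r \<Longrightarrow> 0 \<le> s \<Longrightarrow> 0 \<le> t \<Longrightarrow> dist (r s) (r t) = \<bar>s - t\<bar>"
  by (simp add: geodesic_ray_def)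

text \<open>
  Two points at distance \<open>h\<close> from the apex form an angle of at most \<open>\<theta> / 2 < \<pi>\<close>. By the law of
  cosines their distance is less than \<open>2 h\<close>.
\<close>

lemma geodesic_ray_avoids_small_cone:
  assumes "conical_at \<theta> z" "0 < \<theta>" "\<theta> < 2 * pi" "geodesic_ray r" "0 < t"
  shows "r t \<noteq> z"
proof
  assume z: "r t = z"
  obtain e f where e: "e > 0" "f z = (0, 0)"
    "\<And>r. r \<le> e \<Longrightarrow> f ` ball z r = {q \<in> cone \<theta>. fst q < r}"
    and iso: "\<And>u v. u \<in> ball z e \<Longrightarrow> v \<in> ball z e \<Longrightarrow> cone_dist \<theta> (f u) (f v) = dist u v"
    using conical_at_balls[OF assms(1)] by blast
  define h where "h = min t (e/2)"
  have h: "h > 0" "h \<le> t" "h < e" using e(1) assms(5) by (auto simp: h_def)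
  define u where "u = r (t - h)"
  define v where "v = r (t + h)"
  have d: "dist u z = h" "dist v z = h" "dist u v = 2 * h"
    using h assms(4) by (auto simp: u_def v_def z[symmetric] geodesic_ray_dist)
  have ball: "u \<in> ball z e" "v \<in> ball z e" using d h by (auto simp: dist_commute)
  have cone: "f u \<in> cone \<theta>" "f v \<in> cone \<theta>" using ball e(3)[of e] by auto
  obtain a where a: "f u = (h, a)" "0 \<le> a" "a < \<theta>"
    using iso[OF ball(1), of z] e(1,2) cone(1) cone_dist_apex[OF cone(1)] d(1) h by (cases "f u") (auto simp: cone_def)
  obtain b where b: "f v = (h, b)" "0 \<le> b" "b < \<theta>"
    using iso[OF ball(2), of z] e(1,2) cone(2) cone_dist_apex[OF cone(2)] d(2) h by (cases "f v") (auto simp: cone_def)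
  define \<delta> where "\<delta> = min pi (cone_angle_dist \<theta> a b)"
  have \<delta>: "0 \<le> \<delta>" "\<delta> < pi"
    using a b assms(3) by (auto simp: \<delta>_def cone_angle_dist_def min_def)
  have "sqrt (h\<^sup>2 + h\<^sup>2 - 2 * h * h * cos \<delta>) = 2 * h"
    using iso[OF ball] a b d(3) by (simp add: cone_dist_def \<delta>_def)
  then have "h\<^sup>2 + h\<^sup>2 - 2 * h * h * cos \<delta> = (2 * h)\<^sup>2"
    using h(1) by (metis real_sqrt_eq_iff real_sqrt_abs abs_of_nonneg less_imp_le mult_pos_pos zero_less_numeral)
  then have "(2 * h * h) * (cos \<delta> + 1) = 0"
    by (simp add: power2_eq_square algebra_simps)
  then have "cos \<delta> = cos pi"
    using h(1) by simp
  then have "\<delta> = pi" by (rule cos_inj_pi[OF \<delta>(1) less_imp_le[OF \<delta>(2)] pi_ge_zero order_refl])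
  then show False using \<delta> by simp
qed

lemma ray_end_eq_iff:
  assumes "geodesic_ray r" "geodesic_ray r'"
  shows "ray_end r = ray_end r' \<longleftrightarrow> (\<exists>K. \<forall>t\<ge>0. dist (r t) (r' t) \<le> K)"
proof -
  have "ray_end r = ray_end r' \<longleftrightarrow> (r, r') \<in> asymptotic_rays"
    unfolding ray_end_def using assms by (intro eq_equiv_class_iff[OF equiv_asymptotic_rays]) auto
  then show ?thesis using assms unfolding asymptotic_rays_def by blast
qed

lemma ray_end_in_boundary: "geodesic_ray r \<Longrightarrow> ray_end r \<in> visual_boundary"
  unfolding ray_end_def visual_boundary_def by (intro quotientI) simp

text \<open>
  Rays with the same origin which meet do so at the same time, so that the initial piece of one may
  be followed by the rest of the other: the distance from the origin shows that the new path is
  still shortest.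
\<close>

lemma geodesic_ray_concat:
  assumes r: "geodesic_ray r" and r': "geodesic_ray r'" and eq: "r 0 = r' 0" "r t = r' t" and t: "0 \<le> t"
  defines "c \<equiv> \<lambda>u. if u \<le> t then r u else r' u"
  shows "geodesic_ray c" "ray_end c = ray_end r'"
proof -
  have mixed: "dist (r u) (r' v) = v - u" if "0 \<le> u" "u \<le> t" "t \<le> v" for u v
  proof (rule antisym)
    have "dist (r u) (r' v) \<le> dist (r u) (r t) + dist (r' t) (r' v)"
      using dist_triangle[of "r u" "r' v" "r t"] eq by simp
    then show "dist (r u) (r' v) \<le> v - u"
      using that by (simp add: geodesic_ray_dist[OF r] geodesic_ray_dist[OF r'])
    have "dist (r' 0) (r' v) \<le> dist (r 0) (r u) + dist (r u) (r' v)"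
      using dist_triangle[of "r' 0" "r' v" "r u"] eq by simp
    then show "v - u \<le> dist (r u) (r' v)"
      using that by (simp add: geodesic_ray_dist[OF r] geodesic_ray_dist[OF r'])
  qed
  show c: "geodesic_ray c"
    unfolding geodesic_ray_def
  proof (intro allI impI)
    fix u v :: real assume uv: "0 \<le> u" "0 \<le> v"
    consider "u \<le> t" "v \<le> t" | "u \<le> t" "t < v" | "t < u" "v \<le> t" | "t < u" "t < v" by linarith
    then show "dist (c u) (c v) = \<bar>u - v\<bar>"
    proof cases
      case 3
      then show ?thesis using mixed[of v u] uv by (simp add: c_def dist_commute)
    qed (use mixed[of u v] uv geodesic_ray_dist[OF r, of u v] geodesic_ray_dist[OF r', of u v] in \<open>auto simp: c_def\<close>)
  qed
  have "dist (c u) (r' u) \<le> 2 * t" if "0 \<le> u" for u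
  proof (cases "u \<le> t")
    case True
    have "dist (r u) (r' u) \<le> dist (r 0) (r u) + dist (r' 0) (r' u)"
      using dist_triangle3[of "r u" "r' u" "r 0"] eq by simp
    then show ?thesis
      using True that by (simp add: c_def geodesic_ray_dist[OF r] geodesic_ray_dist[OF r'])
  qed (use t in \<open>simp add: c_def\<close>)
  then show "ray_end c = ray_end r'"
    using ray_end_eq_iff[OF c r'] by blast
qed

text \<open>
  Rays are 1-Lipschitz, so that pointwise convergence on a finite grid controls them in between.
\<close>

lemma geodesic_rays_uniform_limit:
  fixes rs :: "nat \<Rightarrow> real \<Rightarrow> 'b::metric_space"
  assumes rs: "\<And>n. geodesic_ray (rs n)" and r: "geodesic_ray r"
    and lim: "\<And>t. 0 \<le> t \<Longrightarrow> (\<lambda>n. rs n t) \<longlonglongrightarrow> r t" and K: "compact K" "K \<subseteq> {0..}"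
  shows "uniform_limit K rs r sequentially"
proof (rule uniform_limitI)
  fix e :: real assume e: "0 < e"
  define \<delta> where "\<delta> = e / 4"
  have \<delta>: "\<delta> > 0" using e by (simp add: \<delta>_def)
  obtain T where T: "\<And>t. t \<in> K \<Longrightarrow> t \<le> T"
    using compact_imp_bounded[OF K(1)] bounded_imp_bdd_above bdd_above_def by metis
  define M where "M = nat \<lfloor>T / \<delta>\<rfloor>"
  have "eventually (\<lambda>n. dist (rs n (real i * \<delta>)) (r (real i * \<delta>)) < \<delta>) sequentially" for i
    using lim[of "real i * \<delta>"] \<delta> by (auto simp: tendsto_iff)
  then have "eventually (\<lambda>n. \<forall>i\<in>{..M}. dist (rs n (real i * \<delta>)) (r (real i * \<delta>)) < \<delta>) sequentially"
    by (intro eventually_ball_finite) auto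
  then show "eventually (\<lambda>n. \<forall>t\<in>K. dist (rs n t) (r t) < e) sequentially"
  proof (rule eventually_mono, intro ballI)
    fix n t assume n: "\<forall>i\<in>{..M}. dist (rs n (real i * \<delta>)) (r (real i * \<delta>)) < \<delta>" and t: "t \<in> K"
    define i where "i = nat \<lfloor>t / \<delta>\<rfloor>"
    define u where "u = real i * \<delta>"
    have t0: "0 \<le> t" using t K(2) by auto
    have "real i = \<lfloor>t / \<delta>\<rfloor>" using t0 \<delta> by (simp add: i_def)
    then have "real i \<le> t / \<delta>" "t / \<delta> < real i + 1" by linarith+
    then have u: "u \<le> t" "t < u + \<delta>" "0 \<le> u" using \<delta> by (simp_all add: u_def field_simps)
    have "i \<le> M" unfolding i_def M_def using T[OF t] \<delta> by (intro nat_mono floor_mono divide_right_mono) auto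
    then have "dist (rs n u) (r u) < \<delta>" using n by (simp add: u_def)
    moreover have "dist (rs n t) (rs n u) < \<delta>" "dist (r u) (r t) < \<delta>"
      using geodesic_ray_dist[OF rs t0 u(3)] geodesic_ray_dist[OF r u(3) t0] u by auto
    ultimately have "dist (rs n t) (r t) < 3 * \<delta>"
      using dist_triangle[of "rs n t" "r t" "rs n u"] dist_triangle[of "rs n u" "r t" "r u"] by linarith
    then show "dist (rs n t) (r t) < e" using e by (simp add: \<delta>_def)
  qed
qed

text \<open>
  The theorem of Arzela and Ascoli for rays from a point: a diagonal subsequence converges at all
  nonnegative rational times, and therefore, by the Lipschitz condition, at all times.
\<close>

lemma geodesic_rays_convergent_subsequence:
  fixes rs :: "nat \<Rightarrow> real \<Rightarrow> 'b::metric_space"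
  assumes proper: "\<And>r. compact (cball x r)"
    and rs: "\<And>n. geodesic_ray (rs n)" "\<And>n. rs n 0 = x"
  obtains \<phi> r where "strict_mono \<phi>" "geodesic_ray r" "r 0 = x"
    "\<And>t. 0 \<le> t \<Longrightarrow> (\<lambda>n. rs (\<phi> n) t) \<longlonglongrightarrow> r t"
proof -
  define d where "d m = real (fst (prod_decode m)) / real (Suc (snd (prod_decode m)))" for m
  have d0: "0 \<le> d m" for m by (simp add: d_def)
  have dense: "\<exists>m. \<bar>d m - t\<bar> < e" if te: "0 \<le> t" "0 < e" for t e
  proof -
    obtain j where j: "inverse (real (Suc j)) < e" using te(2) reals_Archimedean by blast
    define i where "i = nat \<lfloor>t * real (Suc j)\<rfloor>"
    have "0 \<le> t * real (Suc j)" using te(1) by simp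
    then have "real i = \<lfloor>t * real (Suc j)\<rfloor>" by (simp only: i_def) simp
    then have "real i \<le> t * real (Suc j)" "t * real (Suc j) < real i + 1" by linarith+
    then have "real i / real (Suc j) \<le> t" "t < real i / real (Suc j) + inverse (real (Suc j))"
      by (simp_all add: field_simps)
    then have "\<bar>d (prod_encode (i, j)) - t\<bar> < e" using j by (simp add: d_def)
    then show ?thesis by blast
  qed
  have in_ball: "rs n t \<in> cball x t" if "0 \<le> t" for n t
    using geodesic_ray_dist[OF rs(1)[of n], of 0 t] rs(2)[of n] that by simp
  interpret subseqs "\<lambda>m s. convergent (\<lambda>n. rs (s n) (d m))"
  proof
    fix m and s :: "nat \<Rightarrow> nat" assume "strict_mono s"
    have "seq_compact (cball x (d m))" using proper by (rule compact_imp_seq_compact)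
    then obtain l \<rho> where "strict_mono \<rho>" "((\<lambda>n. rs (s n) (d m)) \<circ> \<rho>) \<longlonglongrightarrow> l"
      using seq_compactE[of "cball x (d m)" "\<lambda>n. rs (s n) (d m)"] in_ball[OF d0[of m]] by blast
    then show "\<exists>\<rho>. strict_mono \<rho> \<and> convergent (\<lambda>n. rs ((s \<circ> \<rho>) n) (d m))"
      by (intro exI[of _ \<rho>]) (auto simp: o_def convergent_def)
  qed
  define \<phi> where "\<phi> = diagseq"
  have conv: "convergent (\<lambda>n. rs (\<phi> n) (d m))" for m
  proof -
    have "convergent (\<lambda>n. rs ((diagseq \<circ> ((+) (Suc m))) n) (d m))"
    proof (rule diagseq_holds)
      fix \<rho> s :: "nat \<Rightarrow> nat" and m
      assume "strict_mono \<rho>" "convergent (\<lambda>n. rs (s n) (d m))"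
      then show "convergent (\<lambda>n. rs ((s \<circ> \<rho>) n) (d m))"
        using convergent_subseq_convergent[of "\<lambda>n. rs (s n) (d m)" \<rho>] by (simp add: o_def)
    qed
    then obtain l where "(\<lambda>n. rs (\<phi> (n + Suc m)) (d m)) \<longlonglongrightarrow> l"
      by (auto simp: convergent_def \<phi>_def add.commute)
    then show ?thesis
      using LIMSEQ_offset[of "\<lambda>n. rs (\<phi> n) (d m)" "Suc m" l] by (auto simp: convergent_def)
  qed
  have "\<exists>l. (\<lambda>n. rs (\<phi> n) t) \<longlonglongrightarrow> l" if t: "0 \<le> t" for t
  proof -
    have "Cauchy (\<lambda>n. rs (\<phi> n) t)"
    proof (rule metric_CauchyI)
      fix e :: real assume "0 < e"
      then obtain m where m: "\<bar>d m - t\<bar> < e / 3" using dense[OF t, of "e/3"] by auto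
      obtain M where M: "\<And>i j. M \<le> i \<Longrightarrow> M \<le> j \<Longrightarrow> dist (rs (\<phi> i) (d m)) (rs (\<phi> j) (d m)) < e / 3"
        using metric_CauchyD[OF convergent_Cauchy[OF conv[of m]], of "e/3"] \<open>0 < e\<close> by auto
      have "dist (rs (\<phi> i) t) (rs (\<phi> j) t) < e" if "M \<le> i" "M \<le> j" for i j
      proof -
        have "dist (rs (\<phi> i) t) (rs (\<phi> i) (d m)) < e/3" "dist (rs (\<phi> j) (d m)) (rs (\<phi> j) t) < e/3"
          using geodesic_ray_dist[OF rs(1) t d0] geodesic_ray_dist[OF rs(1) d0 t] m by (auto simp: abs_minus_commute)
        then show ?thesis
          using M[OF that] dist_triangle[of "rs (\<phi> i) t" "rs (\<phi> j) t" "rs (\<phi> i) (d m)"]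
            dist_triangle[of "rs (\<phi> i) (d m)" "rs (\<phi> j) t" "rs (\<phi> j) (d m)"] by linarith
      qed
      then show "\<exists>M. \<forall>i\<ge>M. \<forall>j\<ge>M. dist (rs (\<phi> i) t) (rs (\<phi> j) t) < e" by blast
    qed
    moreover have "complete (cball x t)" using proper by (rule compact_imp_complete)
    ultimately show ?thesis
      using completeE[of "cball x t" "\<lambda>n. rs (\<phi> n) t"] in_ball[OF t] by blast
  qed
  then obtain r where r: "\<And>t. 0 \<le> t \<Longrightarrow> (\<lambda>n. rs (\<phi> n) t) \<longlonglongrightarrow> r t" by metis
  have "geodesic_ray r"
    unfolding geodesic_ray_def
  proof (intro allI impI)
    fix s t :: real assume st: "0 \<le> s" "0 \<le> t"
    have "(\<lambda>n. dist (rs (\<phi> n) s) (rs (\<phi> n) t)) \<longlonglongrightarrow> dist (r s) (r t)"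
      by (intro tendsto_dist r st)
    moreover have "(\<lambda>n. dist (rs (\<phi> n) s) (rs (\<phi> n) t)) = (\<lambda>n. \<bar>s - t\<bar>)"
      using geodesic_ray_dist[OF rs(1) st] by simp
    ultimately show "dist (r s) (r t) = \<bar>s - t\<bar>"
      using LIMSEQ_unique tendsto_const by metis
  qed
  moreover have "r 0 = x"
    using r[of 0] LIMSEQ_unique[OF _ tendsto_const] by (simp add: rs(2))
  ultimately show ?thesis
    using that r subseq_diagseq unfolding \<phi>_def by blast
qed

lemma boundary_converges_limitin:
  assumes "boundary_converges x \<xi>s \<xi>"
  shows "limitin (boundary_topology x) \<xi>s \<xi> sequentially"
proof -
  have "\<xi> \<in> visual_boundary"
    using assms ray_end_in_boundary unfolding boundary_converges_def by blast
  then show ?thesis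
    using assms unfolding limitin_def topspace_boundary_topology openin_boundary_topology by blast
qed

text \<open>
  A boundary point that is not the end of a ray from \<open>x\<close> is not the limit of any sequence, so it is
  isolated. The circle has no isolated points.
\<close>

lemma based_ray_exists:
  assumes homeo: "boundary_topology x homeomorphic_space top_of_set (sphere (0::complex) 1)"
    and \<xi>: "\<xi> \<in> visual_boundary"
  obtains r where "geodesic_ray r" "r 0 = x" "ray_end r = \<xi>"
proof (rule ccontr)
  assume "\<not> thesis"
  then have "openin (boundary_topology x) {\<xi>}"
    using \<xi> that unfolding openin_boundary_topology boundary_converges_def by blast
  moreover obtain h where h: "homeomorphic_map (boundary_topology x) (top_of_set (sphere (0::complex) 1)) h"
    using homeo homeomorphic_space by blast
  ultimately have op: "openin (top_of_set (sphere 0 1)) {h \<xi>}"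
    using homeomorphic_map_openness_eq[OF h, of "{\<xi>}"] by (metis image_empty image_insert)
  then have "h \<xi> \<in> sphere 0 1" using openin_imp_subset by blast
  moreover have "connected (sphere (0::complex) 1)" by (rule connected_sphere) simp
  moreover have "sphere (0::complex) 1 \<noteq> {w}" for w
  proof
    assume "sphere (0::complex) 1 = {w}"
    moreover have "1 \<in> sphere (0::complex) 1" "-1 \<in> sphere (0::complex) 1" by simp_all
    ultimately show False by (metis neg_equal_iff_equal one_neq_neg_one singletonD)
  qed
  ultimately have "h \<xi> islimpt sphere 0 1" by (intro connected_imp_perfect)
  moreover obtain S where S: "open S" "{h \<xi>} = sphere 0 1 \<inter> S" using op by (auto simp: openin_open)
  ultimately obtain w where "w \<in> sphere 0 1" "w \<in> S" "w \<noteq> h \<xi>"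
    unfolding islimpt_def by blast
  then show False using S by blast
qed

section \<open>Sectors of geodesic rays\<close>

lemma euclidean_at_complex_chart:
  fixes y :: "'a::metric_space"
  assumes "euclidean_at y" "b > 0"
  obtains e and f :: "'a \<Rightarrow> complex" where "0 < e" "e \<le> b" "f y = 0" "f ` ball y e = ball 0 e"
    "\<And>u v. u \<in> ball y e \<Longrightarrow> v \<in> ball y e \<Longrightarrow> dist (f u) (f v) = dist u v"
proof -
  obtain d f where d: "d > 0" "f y = (0::real^2)" "\<And>r. r \<le> d \<Longrightarrow> f ` ball y r = ball 0 r"
    "\<And>u v. u \<in> ball y d \<Longrightarrow> v \<in> ball y d \<Longrightarrow> dist (f u) (f v) = dist u v"
    using euclidean_at_balls[OF assms(1)] by blast
  define c where "c x = Complex (x $ 1) (x $ 2)" for x :: "real^2"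
  have cd: "dist (c x) (c x') = dist x x'" for x x'
    by (simp add: c_def dist_norm norm_vec_def L2_set_def sum_2 cmod_def)
  have "c (vector [Re w, Im w]) = w" for w :: complex by (simp add: c_def)
  then have surj: "\<exists>x. c x = w" for w :: complex by blast
  have c0: "c 0 = 0" by (simp add: c_def complex_eq_iff)
  define e where "e = min d b"
  have e: "e > 0" "e \<le> b" "e \<le> d" using d assms(2) by (auto simp: e_def)
  have "c ` ball 0 e = ball 0 e"
  proof (intro equalityI subsetI)
    fix w :: complex assume "w \<in> c ` ball 0 e"
    then show "w \<in> ball 0 e" using cd[of 0] c0 by auto
  next
    fix w :: complex assume w: "w \<in> ball 0 e"
    obtain x where "c x = w" using surj by blast
    then show "w \<in> c ` ball 0 e" using cd[of 0 x] c0 w by (auto intro!: image_eqI[of _ _ x])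
  qed
  then have "(c \<circ> f) ` ball y e = ball 0 e"
    by (simp only: image_comp[symmetric] d(3)[OF e(3)])
  moreover have "(c \<circ> f) y = 0" using d(2) c0 by simp
  moreover have "dist ((c \<circ> f) u) ((c \<circ> f) v) = dist u v" if "u \<in> ball y e" "v \<in> ball y e" for u v
    using that e d(4) cd by auto
  ultimately show ?thesis using that e by blast
qed

text \<open>
  An isometric curve in an inner product space is straight. The direction is read off from the time
  interval from \<open>a - k\<close> to \<open>a\<close>, so that the course of a geodesic after time \<open>a\<close> is expressed by its
  course before.
\<close>

lemma isometric_line:
  fixes g :: "real \<Rightarrow> 'v::real_inner"
  assumes "\<And>s t. s \<in> I \<Longrightarrow> t \<in> I \<Longrightarrow> dist (g s) (g t) = \<bar>s - t\<bar>"
    and "a \<in> I" "a - k \<in> I" "s \<in> I" "k > 0"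
  shows "g s = g a + (s - a) *\<^sub>R ((g a - g (a - k)) /\<^sub>R k)"
proof -
  define h where "h = s - a"
  define u where "u = g s - g a"
  define v where "v = (g a - g (a - k)) /\<^sub>R k"
  have kv: "g a - g (a - k) = k *\<^sub>R v" using assms(5) by (simp add: v_def)
  have "norm u = \<bar>h\<bar>" using assms by (simp add: u_def h_def dist_norm[symmetric])
  then have u: "u \<bullet> u = h\<^sup>2" by (simp add: power2_norm_eq_inner[symmetric])
  have "norm (k *\<^sub>R v) = k" unfolding kv[symmetric] using assms by (simp add: dist_norm[symmetric])
  then have "norm v = 1" using assms(5) by simp
  then have v: "v \<bullet> v = 1" by (simp add: norm_eq_1)
  have "norm (u + k *\<^sub>R v) = \<bar>h + k\<bar>"
    unfolding kv[symmetric] using assms by (simp add: u_def h_def dist_norm[symmetric] algebra_simps)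
  then have "(u + k *\<^sub>R v) \<bullet> (u + k *\<^sub>R v) = (h + k)\<^sup>2" by (simp add: power2_norm_eq_inner[symmetric])
  then have "k * (u \<bullet> v) = k * h"
    using u v by (simp add: inner_add_left inner_add_right inner_commute power2_eq_square algebra_simps)
  then have uv: "u \<bullet> v = h" using assms(5) by simp
  have "(u - h *\<^sub>R v) \<bullet> (u - h *\<^sub>R v) = 0"
    using u v uv by (simp add: inner_diff_left inner_diff_right inner_commute power2_eq_square)
  then have "u = h *\<^sub>R v" by simp
  then show ?thesis by (simp add: u_def v_def h_def algebra_simps)
qed

text \<open>
  The witness is the first point where the value \<open>c\<close> is taken. This is how to step off a closed set,
  such as the parameters of the rays through a point, without going far from it.
\<close>

lemma first_hit:
  fixes \<phi> :: "real \<Rightarrow> real"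
  assumes "continuous_on {a..b} \<phi>" "a \<le> b" "\<phi> a < c" "c \<le> \<phi> b"
  obtains \<beta> where "a < \<beta>" "\<beta> \<le> b" "\<phi> \<beta> = c" "\<And>s. a \<le> s \<Longrightarrow> s \<le> \<beta> \<Longrightarrow> \<phi> s \<le> c"
proof -
  define H where "H = {s \<in> {a..b}. \<phi> s = c}"
  have "closed H"
    unfolding H_def using assms(1) by (intro continuous_closed_preimage_constant) auto
  then have "compact ({a..b} \<inter> H)" by (intro compact_Int_closed) auto
  moreover have "{a..b} \<inter> H = H" by (auto simp: H_def)
  ultimately have "compact H" by simp
  moreover have "H \<noteq> {}"
    using IVT'[of \<phi> a c b] assms by (auto simp: H_def)
  ultimately obtain \<beta> where \<beta>: "\<beta> \<in> H" "\<And>s. s \<in> H \<Longrightarrow> \<beta> \<le> s"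
    using compact_attains_inf by metis
  have "\<phi> s \<le> c" if s: "a \<le> s" "s \<le> \<beta>" for s
  proof (rule ccontr)
    assume "\<not> \<phi> s \<le> c"
    moreover have "s \<le> b" using s \<beta>(1) by (auto simp: H_def)
    ultimately obtain u where "a \<le> u" "u \<le> s" "\<phi> u = c"
      using IVT'[of \<phi> a c s] assms s continuous_on_subset[OF assms(1), of "{a..s}"] by auto
    then have "\<beta> \<le> u" using \<beta>(2)[of u] \<open>s \<le> b\<close> by (auto simp: H_def)
    then have "u = s" using \<open>u \<le> s\<close> s by auto
    then show False using \<open>\<phi> u = c\<close> \<open>\<not> \<phi> s \<le> c\<close> by simp
  qed
  then show ?thesis
    using that[of \<beta>] \<beta>(1) assms(3) by (auto simp: H_def order_le_less)
qed

lemma first_hit_left: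
  fixes \<phi> :: "real \<Rightarrow> real"
  assumes "continuous_on {a..b} \<phi>" "a \<le> b" "\<phi> b < c" "c \<le> \<phi> a"
  obtains \<alpha> where "a \<le> \<alpha>" "\<alpha> < b" "\<phi> \<alpha> = c" "\<And>s. \<alpha> \<le> s \<Longrightarrow> s \<le> b \<Longrightarrow> \<phi> s \<le> c"
proof -
  have "continuous_on {-b..-a} (\<lambda>s. \<phi> (- s))"
    by (rule continuous_on_compose2[OF assms(1)]) (auto intro: continuous_intros)
  then obtain \<beta> where \<beta>: "-b < \<beta>" "\<beta> \<le> -a" "\<phi> (-\<beta>) = c" "\<And>s. -b \<le> s \<Longrightarrow> s \<le> \<beta> \<Longrightarrow> \<phi> (-s) \<le> c"
    using first_hit[of "-b" "-a" "\<lambda>s. \<phi> (- s)" c] assms by auto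
  have "\<phi> s \<le> c" if "-\<beta> \<le> s" "s \<le> b" for s
    using \<beta>(4)[of "-s"] that by simp
  then show ?thesis using that[of "-\<beta>"] \<beta> by auto
qed

text \<open>
  A continuous family of rays from \<open>x0\<close>, parametrised by the boundary points of an arc, in which no
  boundary point is the end of two rays. The latter is expressed by \<open>uniq\<close>: rays which meet have
  run together since \<open>x0\<close>.
\<close>

locale ray_sector =
  fixes F :: "real \<Rightarrow> real \<Rightarrow> 'b::metric_space" and a b :: real and x0 :: 'b and Z :: "'b set"
  assumes ab: "a < b"
    and ray: "\<And>s. s \<in> {a..b} \<Longrightarrow> geodesic_ray (F s)"
    and start: "\<And>s. s \<in> {a..b} \<Longrightarrow> F s 0 = x0"
    and cont: "\<And>t. 0 \<le> t \<Longrightarrow> continuous_on {a..b} (\<lambda>s. F s t)"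
    and uniq: "\<And>s s' t u. s \<in> {a..b} \<Longrightarrow> s' \<in> {a..b} \<Longrightarrow> 0 \<le> u \<Longrightarrow> u \<le> t \<Longrightarrow> F s t = F s' t \<Longrightarrow> F s u = F s' u"
    and distinct: "\<And>s s'. s \<in> {a..b} \<Longrightarrow> s' \<in> {a..b} \<Longrightarrow> s \<noteq> s' \<Longrightarrow> \<exists>t\<ge>0. F s t \<noteq> F s' t"
    and regular: "\<And>x. x \<notin> Z \<Longrightarrow> euclidean_at x"
    and countable: "countable Z"
begin

lemma distF: "s \<in> {a..b} \<Longrightarrow> 0 \<le> t \<Longrightarrow> 0 \<le> u \<Longrightarrow> dist (F s t) (F s u) = \<bar>t - u\<bar>"
  using ray geodesic_ray_dist by blast

lemma dist_start: "s \<in> {a..b} \<Longrightarrow> 0 \<le> t \<Longrightarrow> dist x0 (F s t) = t"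
  using distF[of s 0 t] start[of s] by simp

lemma same_time: "s \<in> {a..b} \<Longrightarrow> s' \<in> {a..b} \<Longrightarrow> 0 \<le> t \<Longrightarrow> 0 \<le> t' \<Longrightarrow> F s t = F s' t' \<Longrightarrow> t = t'"
  using dist_start by metis

text \<open>
  Rays that run together separate eventually, and the point where they do so is singular: near a
  regular point both are straight, so each is determined by the common part.
\<close>

lemma branch_singular:
  assumes s: "s \<in> {a..b}" "s' \<in> {a..b}" "s \<noteq> s'" and t: "0 < t" and eq: "F s t = F s' t"
  obtains \<tau> where "t \<le> \<tau>" "F s \<tau> \<in> Z"
proof -
  define A where "A = {u. 0 \<le> u \<and> F s u = F s' u}"
  obtain u0 where u0: "0 \<le> u0" "F s u0 \<noteq> F s' u0" using distinct s by blast
  have bd: "u \<le> u0" if "u \<in> A" for u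
    using uniq[OF s(1,2), of u0 u] that u0 by (force simp: A_def)
  define \<tau> where "\<tau> = Sup A"
  have bdd: "bdd_above A" using bd by (rule bdd_aboveI)
  have "t \<in> A" using t eq by (simp add: A_def)
  then have t\<tau>: "t \<le> \<tau>" unfolding \<tau>_def using bdd by (rule cSup_upper)
  have below: "F s u = F s' u" if u: "0 \<le> u" "u < \<tau>" for u
  proof -
    obtain v where "v \<in> A" "u < v"
      using u(2) \<open>t \<in> A\<close> bdd unfolding \<tau>_def by (metis empty_iff less_cSup_iff)
    then show ?thesis using uniq[OF s(1,2), of u v] u by (auto simp: A_def)
  qed
  have "F s \<tau> = F s' \<tau>"
  proof (rule ccontr)
    assume ne: "F s \<tau> \<noteq> F s' \<tau>"
    define d where "d = min t (dist (F s \<tau>) (F s' \<tau>) / 3)"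
    have d: "0 < d" "d \<le> t" "2 * d < dist (F s \<tau>) (F s' \<tau>)"
      using ne t by (auto simp: d_def min_def)
    have "dist (F s \<tau>) (F s (\<tau> - d)) = d" "dist (F s' (\<tau> - d)) (F s' \<tau>) = d"
      using distF s d t\<tau> by auto
    then have "dist (F s \<tau>) (F s' \<tau>) \<le> 2 * d"
      using dist_triangle[of "F s \<tau>" "F s' \<tau>" "F s (\<tau> - d)"] below[of "\<tau> - d"] d t\<tau> by auto
    then show False using d by simp
  qed
  note eq\<tau> = this
  have "F s \<tau> \<in> Z"
  proof (rule ccontr)
    assume "F s \<tau> \<notin> Z"
    then obtain e f where e: "0 < e" "e \<le> t"
      and iso: "\<And>u v. u \<in> ball (F s \<tau>) e \<Longrightarrow> v \<in> ball (F s \<tau>) e \<Longrightarrow> dist (f u) (f v :: complex) = dist u v"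
      using euclidean_at_complex_chart[OF regular, of "F s \<tau>" t] t by metis
    define I where "I = {\<tau> - e/2..\<tau> + e/2}"
    have I: "r \<in> I \<Longrightarrow> 0 \<le> r" for r using e t\<tau> by (auto simp: I_def)
    have line: "f (F r (\<tau> + e/2)) = f (F r \<tau>) + (\<tau> + e/2 - \<tau>) *\<^sub>R ((f (F r \<tau>) - f (F r (\<tau> - e/2))) /\<^sub>R (e/2))"
      and ball: "F r (\<tau> + e/2) \<in> ball (F s \<tau>) e"
      if r: "r \<in> {s, s'}" for r
    proof -
      have rI: "r \<in> {a..b}" "F r \<tau> = F s \<tau>" using r s eq\<tau> by auto
      have ball: "F r u \<in> ball (F s \<tau>) e" if "u \<in> I" for u
        using distF[OF rI(1), of \<tau> u] rI(2) that I[OF that] e t\<tau> by (auto simp: I_def)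
      have "\<tau> + e/2 \<in> I" using e by (auto simp: I_def)
      then show "F r (\<tau> + e/2) \<in> ball (F s \<tau>) e" by (rule ball)
      show "f (F r (\<tau> + e/2)) = f (F r \<tau>) + (\<tau> + e/2 - \<tau>) *\<^sub>R ((f (F r \<tau>) - f (F r (\<tau> - e/2))) /\<^sub>R (e/2))"
      proof (rule isometric_line[where I = I])
        show "dist (f (F r u)) (f (F r v)) = \<bar>u - v\<bar>" if "u \<in> I" "v \<in> I" for u v
          using iso[OF ball[OF that(1)] ball[OF that(2)]] distF[OF rI(1) I[OF that(1)] I[OF that(2)]] by simp
      qed (use e in \<open>auto simp: I_def\<close>)
    qed
    have "f (F s (\<tau> + e/2)) = f (F s' (\<tau> + e/2))"
      using line[of s] line[of s'] eq\<tau> below[of "\<tau> - e/2"] e t\<tau> by auto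
    then have "F s (\<tau> + e/2) = F s' (\<tau> + e/2)"
      using iso[OF ball[of s] ball[of s']] by simp
    then have "\<tau> + e/2 \<in> A" using e t\<tau> t by (simp add: A_def)
    then have "\<tau> + e/2 \<le> \<tau>" unfolding \<tau>_def using bdd by (rule cSup_upper)
    then show False using e by simp
  qed
  then show ?thesis using that t\<tau> by blast
qed

definition swept :: "real \<Rightarrow> 'b set" where
  "swept T = {F s t | s t. s \<in> {a..b} \<and> 0 \<le> t \<and> t \<le> T}"

text \<open>
  In a chart \<open>f\<close> around \<open>y\<close> the ray with parameter \<open>s\<close> near \<open>s0\<close> is a segment through \<open>A s\<close> with unit
  direction \<open>V s\<close>, and \<open>D q s\<close> is the signed distance of the point \<open>q\<close> from it. Thus the ray meets \<open>q\<close>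
  exactly if \<open>D q s = 0\<close>. There are parameters \<open>\<alpha> < s0 < \<beta>\<close> near \<open>s0\<close> whose rays avoid \<open>y\<close>, because the
  extreme rays do.

  If \<open>D 0 \<alpha>\<close> and \<open>D 0 \<beta>\<close> have different signs, then so have \<open>D q \<alpha>\<close> and \<open>D q \<beta>\<close> for all small \<open>q\<close>,
  and the intermediate value theorem gives a ray through \<open>q\<close>.

  If they have the same sign, choose \<open>q = \<eta> w\<close> on the normal of the ray of \<open>s0\<close>, on the side where
  \<open>D q s0\<close> has the other sign. Then there is a ray through \<open>q\<close> with a parameter on either side of
  \<open>s0\<close>. The two rays branch at a singular point. It determines \<open>\<eta>\<close>: a ray through two of the
  points \<open>q\<close> would run along the normal and hence through \<open>y\<close>, but the rays through \<open>y\<close> have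
  the direction \<open>V s0\<close>. So there would be uncountably many singular points.
\<close>

lemma swept_interior:
  assumes s0: "s0 \<in> {a..b}" and t0: "0 < t0" "t0 < T" and y: "F s0 t0 = y" "y \<notin> Z"
    and ends: "F a t0 \<noteq> y" "F b t0 \<noteq> y"
  shows "\<exists>\<eta>>0. ball y \<eta> \<subseteq> swept T"
proof -
  obtain e f where e: "0 < e" "e \<le> min t0 (T - t0)" and fy: "f y = (0::complex)"
    and fball: "f ` ball y e = ball 0 e"
    and iso: "\<And>u v. u \<in> ball y e \<Longrightarrow> v \<in> ball y e \<Longrightarrow> dist (f u) (f v) = dist u v"
    using euclidean_at_complex_chart[OF regular[OF y(2)], of "min t0 (T - t0)"] t0 by auto
  have inj: "u = v" if "u \<in> ball y e" "v \<in> ball y e" "f u = f v" for u v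
    using iso[OF that(1,2)] that(3) by simp
  have normf: "norm (f u) = dist y u" if "u \<in> ball y e" for u
    using iso[of y u] that e fy by simp
  define N where "N = {s \<in> {a..b}. dist y (F s t0) < e/4}"
  define A where "A s = f (F s t0)" for s
  \<comment> \<open>The direction is taken from the past, where all rays through \<open>y\<close> agree.\<close>
  define V where "V s = (A s - f (F s (t0 - e/4))) /\<^sub>R (e/4)" for s
  define D where "D q s = Im ((q - A s) * cnj (V s))" for q s
  have NI: "s \<in> {a..b}" if "s \<in> N" for s using that by (simp add: N_def)
  have Nball: "F s (t0 + h) \<in> ball y e" if "s \<in> N" "\<bar>h\<bar> \<le> e/2" for s h
  proof -
    have "dist (F s t0) (F s (t0 + h)) = \<bar>h\<bar>" using distF[OF NI[OF that(1)], of t0 "t0 + h"] that e t0 by auto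
    then show ?thesis
      using dist_triangle[of y "F s (t0 + h)" "F s t0"] that e by (auto simp: N_def)
  qed
  have line: "f (F s (t0 + h)) = A s + h *\<^sub>R V s" if s: "s \<in> N" and h: "\<bar>h\<bar> \<le> e/2" for s h
  proof -
    have "f (F s (t0 + h)) = f (F s t0) + (t0 + h - t0) *\<^sub>R ((f (F s t0) - f (F s (t0 - e/4))) /\<^sub>R (e/4))"
    proof (rule isometric_line[where I = "{t0 - e/2..t0 + e/2}"])
      show "dist (f (F s u)) (f (F s v)) = \<bar>u - v\<bar>"
        if "u \<in> {t0 - e/2..t0 + e/2}" "v \<in> {t0 - e/2..t0 + e/2}" for u v
      proof -
        have "F s u \<in> ball y e" "F s v \<in> ball y e"
          using Nball[OF s, of "u - t0"] Nball[OF s, of "v - t0"] that by (auto simp: abs_if split: if_splits)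
        then show ?thesis using iso distF[OF NI[OF s], of u v] that e by auto
      qed
    qed (use e h in \<open>auto simp: abs_le_iff\<close>)
    then show ?thesis by (simp add: A_def V_def)
  qed
  have normV: "norm (V s) = 1" if s: "s \<in> N" for s
  proof -
    have "dist (f (F s (t0 + e/4))) (f (F s (t0 + 0))) = dist (F s (t0 + e/4)) (F s (t0 + 0))"
      using Nball[OF s, of "e/4"] Nball[OF s, of 0] e by (intro iso) auto
    also have "\<dots> = e/4" using distF[OF NI[OF s], of "t0 + e/4" "t0 + 0"] e t0 by auto
    finally have "norm ((e/4) *\<^sub>R V s) = e/4"
      using line[OF s, of "e/4"] line[OF s, of 0] e by (simp add: dist_norm)
    then show "norm (V s) = 1" using e by simp
  qed
  have VV: "V s * cnj (V s) = 1" if s: "s \<in> N" for s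
    using normV[OF s] by (simp add: complex_norm_square[symmetric])
  have Anorm: "norm (A s) < e/4" if s: "s \<in> N" for s
    using normf[OF Nball[OF s, of 0]] s e by (simp add: A_def N_def)
  have hit: "\<exists>h. \<bar>h\<bar> < e/2 \<and> f (F s (t0 + h)) = q" if s: "s \<in> N" and q: "norm q < e/4" and "D q s = 0" for q s
  proof -
    define h where "h = Re ((q - A s) * cnj (V s))"
    have "(q - A s) * cnj (V s) = complex_of_real h"
      using that(3) by (simp add: D_def h_def complex_eq_iff)
    moreover have "(q - A s) * (V s * cnj (V s)) = (q - A s) * cnj (V s) * V s" by (simp only: ac_simps)
    ultimately have "(q - A s) * (V s * cnj (V s)) = h * V s" by simp
    then have *: "q - A s = h *\<^sub>R V s" using VV[OF s] by (simp add: scaleR_conv_of_real)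
    have "norm (V s) = 1" using normV s by blast
    then have "norm (q - A s) = \<bar>h\<bar>" using * by simp
    then have "\<bar>h\<bar> < e/2"
      using norm_triangle_ineq4[of q "A s"] q Anorm[OF s] by linarith
    then show ?thesis using line[OF s, of h] * by (intro exI[of _ h]) (simp add: algebra_simps)
  qed
  have on_ray: "D (f (F s (t0 + h))) s = 0" if s: "s \<in> N" and "\<bar>h\<bar> \<le> e/2" for s h
    using line[OF that] VV[OF s] by (simp add: D_def)
  have D0: "F s t0 = y" if s: "s \<in> N" and D: "D 0 s = 0" for s
  proof -
    obtain h where h: "\<bar>h\<bar> < e/2" "f (F s (t0 + h)) = f y" using hit[OF s _ D] e fy by auto
    then have "F s (t0 + h) = y" using Nball[OF s, of h] e by (intro inj) auto
    then have "t0 + h = t0" using same_time[OF NI[OF s] s0, of "t0 + h" t0] y(1) h e t0 by (simp add: abs_if split: if_splits)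
    then show ?thesis using \<open>F s (t0 + h) = y\<close> by simp
  qed
  have s0N: "s0 \<in> N" using s0 y e by (simp add: N_def)
  have Vy: "A s = 0" "V s = V s0" if s: "s \<in> N" and "F s t0 = y" for s
  proof -
    show "A s = 0" using that fy by (simp add: A_def)
    have "F s (t0 - e/4) = F s0 (t0 - e/4)"
      using uniq[OF NI[OF s] s0, of "t0 - e/4" t0] that y e by auto
    then show "V s = V s0" using that y by (simp add: V_def A_def)
  qed
  have contF: "continuous_on N (\<lambda>s. F s t)" if "0 \<le> t" for t
    using cont[OF that] by (rule continuous_on_subset) (auto simp: N_def)
  have contf: "continuous_on (ball y e) f"
    unfolding continuous_on_iff using iso by metis
  have contfF: "continuous_on N (\<lambda>s. f (F s (t0 + h)))" if "\<bar>h\<bar> \<le> e/2" for h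
    using that e t0 Nball by (intro continuous_on_compose2[OF contf contF]) auto
  have contD: "continuous_on N (D q)" for q
  proof -
    have "continuous_on N A" unfolding A_def using contfF[of 0] e by simp
    moreover have "continuous_on N (\<lambda>s. f (F s (t0 - e/4)))" using contfF[of "-(e/4)"] e by simp
    ultimately show ?thesis unfolding D_def V_def by (intro continuous_intros)
  qed
  have Dq: "\<bar>D q s - D 0 s\<bar> \<le> norm q" if s: "s \<in> N" for q s
  proof -
    have "norm (V s) = 1" using normV s by blast
    moreover have "D q s - D 0 s = Im (q * cnj (V s))" by (simp add: D_def algebra_simps)
    ultimately show ?thesis using abs_Im_le_cmod[of "q * cnj (V s)"] by (simp add: norm_mult)
  qed
  define \<phi> where "\<phi> s = dist y (F s t0)" for s
  have cont\<phi>: "continuous_on {a..b} \<phi>" unfolding \<phi>_def using cont[of t0] t0 by (intro continuous_intros) auto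
  obtain \<beta> where \<beta>: "s0 < \<beta>" "\<beta> \<le> b" "F \<beta> t0 \<noteq> y" "{s0..\<beta>} \<subseteq> N"
  proof -
    define c where "c = min (e/8) (\<phi> b)"
    have c: "0 < c" "c < e/4" "c \<le> \<phi> b" using e ends by (auto simp: c_def \<phi>_def min_def)
    obtain \<beta> where \<beta>: "s0 < \<beta>" "\<beta> \<le> b" "\<phi> \<beta> = c" "\<And>s. s0 \<le> s \<Longrightarrow> s \<le> \<beta> \<Longrightarrow> \<phi> s \<le> c"
      using first_hit[of s0 b \<phi> c] continuous_on_subset[OF cont\<phi>, of "{s0..b}"] s0 c y by (auto simp: \<phi>_def)
    then show ?thesis using that[of \<beta>] c s0 by (force simp: \<phi>_def N_def)
  qed
  obtain \<alpha> where \<alpha>: "a \<le> \<alpha>" "\<alpha> < s0" "F \<alpha> t0 \<noteq> y" "{\<alpha>..s0} \<subseteq> N"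
  proof -
    define c where "c = min (e/8) (\<phi> a)"
    have c: "0 < c" "c < e/4" "c \<le> \<phi> a" using e ends by (auto simp: c_def \<phi>_def min_def)
    obtain \<alpha> where \<alpha>: "a \<le> \<alpha>" "\<alpha> < s0" "\<phi> \<alpha> = c" "\<And>s. \<alpha> \<le> s \<Longrightarrow> s \<le> s0 \<Longrightarrow> \<phi> s \<le> c"
      using first_hit_left[of a s0 \<phi> c] continuous_on_subset[OF cont\<phi>, of "{a..s0}"] s0 c y by (auto simp: \<phi>_def)
    then show ?thesis using that[of \<alpha>] c s0 by (force simp: \<phi>_def N_def)
  qed
  have \<alpha>N: "\<alpha> \<in> N" and \<beta>N: "\<beta> \<in> N" using \<alpha> \<beta> by auto
  define \<eta>0 where "\<eta>0 = Min {\<bar>D 0 \<alpha>\<bar>, \<bar>D 0 \<beta>\<bar>, e/4}"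
  have \<eta>0: "0 < \<eta>0" "\<eta>0 \<le> \<bar>D 0 \<alpha>\<bar>" "\<eta>0 \<le> \<bar>D 0 \<beta>\<bar>" "\<eta>0 \<le> e/4"
    using D0[OF \<alpha>N] D0[OF \<beta>N] \<alpha>(3) \<beta>(3) e by (auto simp: \<eta>0_def)
  have root: "\<exists>s\<in>{l..u}. D q s = 0" if lu: "{l..u} \<subseteq> N" "l \<le> u" "D q l * D q u \<le> 0" for q l u
  proof -
    have c: "continuous_on {l..u} (D q)" using contD that(1) by (rule continuous_on_subset)
    have "(D q l \<le> 0 \<and> 0 \<le> D q u) \<or> (D q u \<le> 0 \<and> 0 \<le> D q l)"
      using that(3) by (auto simp: mult_le_0_iff)
    then obtain s where "l \<le> s" "s \<le> u" "D q s = 0"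
      using IVT'[of "D q" l 0 u, OF _ _ lu(2) c] IVT2'[of "D q" u 0 l, OF _ _ lu(2) c] by blast
    then show ?thesis by auto
  qed
  consider (cross) "D 0 \<alpha> * D 0 \<beta> < 0" | (fold) "D 0 \<alpha> * D 0 \<beta> > 0"
    using \<eta>0 by (metis abs_zero linorder_neqE_linordered_idom mult_eq_0_iff not_less)
  then show ?thesis
  proof cases
    case cross
    have "u \<in> swept T" if u: "u \<in> ball y \<eta>0" for u
    proof -
      have ue: "u \<in> ball y e" using u \<eta>0 e by auto
      have q: "norm (f u) < \<eta>0" using normf[OF ue] u by simp
      have "\<bar>D (f u) \<alpha> - D 0 \<alpha>\<bar> < \<bar>D 0 \<alpha>\<bar>" "\<bar>D (f u) \<beta> - D 0 \<beta>\<bar> < \<bar>D 0 \<beta>\<bar>"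
        using Dq[OF \<alpha>N, of "f u"] Dq[OF \<beta>N, of "f u"] q \<eta>0 by linarith+
      then have "D (f u) \<alpha> * D (f u) \<beta> \<le> 0"
        using cross by (auto simp: mult_less_0_iff mult_le_0_iff)
      moreover have "{\<alpha>..\<beta>} \<subseteq> N" using \<alpha>(4) \<beta>(4) by (auto simp: subset_iff) (metis linorder_linear)
      ultimately obtain s where s: "s \<in> N" "D (f u) s = 0"
        using root[of \<alpha> \<beta> "f u"] \<alpha>(2) \<beta>(1) by (auto simp: subset_iff)
      obtain h where h: "\<bar>h\<bar> < e/2" "f (F s (t0 + h)) = f u" using hit[OF s(1) _ s(2)] q \<eta>0 by auto
      then have "F s (t0 + h) = u" using Nball[OF s(1), of h] ue by (intro inj) auto
      moreover have "0 \<le> t0 + h" "t0 + h \<le> T" using h e by (auto simp: abs_less_iff)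
      ultimately show ?thesis using NI[OF s(1)] unfolding swept_def by blast
    qed
    then show ?thesis using \<eta>0(1) by blast
  next
    case fold
    \<comment> \<open>The unit normal for which \<open>D (\<eta> w) s0\<close> and \<open>D 0 \<alpha>\<close> have different signs for \<open>\<eta> > 0\<close>.\<close>
    define w where "w = - sgn (D 0 \<alpha>) *\<^sub>R (\<i> * V s0)"
    have nV: "norm (V s0) = 1" using normV s0N by blast
    have sgn: "\<bar>sgn (D 0 \<alpha>)\<bar> = 1" "sgn (D 0 \<beta>) = sgn (D 0 \<alpha>)"
      using fold by (auto simp: zero_less_mult_iff sgn_if)
    have nw: "norm w = 1" unfolding w_def using nV sgn by (simp add: norm_mult)
    have "w * cnj (V s0) = - sgn (D 0 \<alpha>) *\<^sub>R (\<i> * (V s0 * cnj (V s0)))" by (simp add: w_def)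
    then have wV: "Im (w * cnj (V s0)) = - sgn (D 0 \<alpha>)" unfolding VV[OF s0N] by simp
    have Dw: "D (\<eta> *\<^sub>R w) s = D 0 s + \<eta> * Im (w * cnj (V s))" for \<eta> s
      by (simp add: D_def algebra_simps)
    have ex: "\<exists>s h \<tau>. s \<in> N \<and> \<bar>h\<bar> < e/2 \<and> f (F s (t0 + h)) = \<eta> *\<^sub>R w \<and> t0 + h \<le> \<tau> \<and> F s \<tau> \<in> Z"
      if \<eta>: "0 < \<eta>" "\<eta> < \<eta>0" for \<eta>
    proof -
      define q where "q = \<eta> *\<^sub>R w"
      have nq: "norm q = \<eta>" using nw \<eta> by (simp add: q_def)
      have Ds0: "D q s0 = - \<eta> * sgn (D 0 \<alpha>)"
        using Dw[of \<eta> s0] wV Vy(1)[OF s0N y(1)] by (simp add: q_def D_def)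
      have "\<bar>D q \<alpha> - D 0 \<alpha>\<bar> < \<bar>D 0 \<alpha>\<bar>" "\<bar>D q \<beta> - D 0 \<beta>\<bar> < \<bar>D 0 \<beta>\<bar>"
        using Dq[OF \<alpha>N, of q] Dq[OF \<beta>N, of q] nq \<eta> \<eta>0 by linarith+
      then have "D q \<alpha> * D q s0 \<le> 0" "D q s0 * D q \<beta> \<le> 0"
        unfolding Ds0 using \<eta> fold by (auto simp: zero_less_mult_iff mult_le_0_iff sgn_if zero_le_mult_iff)
      then obtain s s' where s: "s \<in> {\<alpha>..s0}" "D q s = 0" and s': "s' \<in> {s0..\<beta>}" "D q s' = 0"
        using root[OF \<alpha>(4), of q] root[OF \<beta>(4), of q] \<alpha>(2) \<beta>(1) by auto
      have "D q s0 \<noteq> 0" unfolding Ds0 using \<eta> sgn(1) by (metis abs_zero mult_eq_0_iff neg_equal_0_iff_equal less_irrefl zero_neq_one)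
      then have "s \<noteq> s'" using s s' by (metis atLeastAtMost_iff order_antisym)
      have N: "s \<in> N" "s' \<in> N" using s s' \<alpha>(4) \<beta>(4) by auto
      obtain h where h: "\<bar>h\<bar> < e/2" "f (F s (t0 + h)) = q" using hit[OF N(1) _ s(2)] nq \<eta> \<eta>0 by auto
      obtain h' where h': "\<bar>h'\<bar> < e/2" "f (F s' (t0 + h')) = q" using hit[OF N(2) _ s'(2)] nq \<eta> \<eta>0 by auto
      have eq: "F s (t0 + h) = F s' (t0 + h')"
        using Nball[OF N(1), of h] Nball[OF N(2), of h'] h h' by (intro inj) auto
      have pos: "0 < t0 + h" "0 < t0 + h'" using h h' e by (auto simp: abs_less_iff)
      then have "t0 + h = t0 + h'" using same_time[OF NI[OF N(1)] NI[OF N(2)] _ _ eq] by simp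
      then obtain \<tau> where "t0 + h \<le> \<tau>" "F s \<tau> \<in> Z"
        using branch_singular[OF NI[OF N(1)] NI[OF N(2)] \<open>s \<noteq> s'\<close> pos(1)] eq by metis
      then show ?thesis using N(1) h unfolding q_def by blast
    qed
    then obtain S H G where G: "\<And>\<eta>. \<eta> \<in> {0<..<\<eta>0} \<Longrightarrow> S \<eta> \<in> N \<and> \<bar>H \<eta>\<bar> < e/2 \<and>
        f (F (S \<eta>) (t0 + H \<eta>)) = \<eta> *\<^sub>R w \<and> t0 + H \<eta> \<le> G \<eta> \<and> F (S \<eta>) (G \<eta>) \<in> Z"
      by (metis greaterThanLessThan_iff)
    have "inj_on (\<lambda>\<eta>. F (S \<eta>) (G \<eta>)) {0<..<\<eta>0}"
    proof (rule inj_onI, rule ccontr)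
      fix \<eta> \<eta>' assume i: "\<eta> \<in> {0<..<\<eta>0}" "\<eta>' \<in> {0<..<\<eta>0}" "F (S \<eta>) (G \<eta>) = F (S \<eta>') (G \<eta>')" "\<eta> \<noteq> \<eta>'"
      note g = G[OF i(1)] G[OF i(2)]
      have pos: "0 \<le> t0 + H \<eta>" "0 \<le> t0 + H \<eta>'" using g e by (auto simp: abs_less_iff)
      have SI: "S \<eta> \<in> {a..b}" "S \<eta>' \<in> {a..b}" using g NI by auto
      have "G \<eta> = G \<eta>'" using same_time[OF SI _ _ i(3)] pos g by linarith
      then have "F (S \<eta>) (t0 + H \<eta>') = F (S \<eta>') (t0 + H \<eta>')"
        using uniq[OF SI pos(2), of "G \<eta>"] i(3) g by simp
      then have "D (\<eta>' *\<^sub>R w) (S \<eta>) = 0"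
        using on_ray[of "S \<eta>" "H \<eta>'"] g by auto
      moreover have "D (\<eta> *\<^sub>R w) (S \<eta>) = 0"
        using on_ray[of "S \<eta>" "H \<eta>"] g by auto
      ultimately have "D 0 (S \<eta>) + \<eta>' * Im (w * cnj (V (S \<eta>))) = 0" and 1: "D 0 (S \<eta>) + \<eta> * Im (w * cnj (V (S \<eta>))) = 0"
        unfolding Dw by auto
      then have "(\<eta> - \<eta>') * Im (w * cnj (V (S \<eta>))) = 0" by (simp add: algebra_simps)
      then have 2: "Im (w * cnj (V (S \<eta>))) = 0" using i(4) by simp
      then have "D 0 (S \<eta>) = 0" using 1 by simp
      then have "F (S \<eta>) t0 = y" using D0 g by blast
      then have "V (S \<eta>) = V s0" using Vy(2) g by blast
      then show False using 2 wV sgn(1) by simp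
    qed
    moreover have "countable ((\<lambda>\<eta>. F (S \<eta>) (G \<eta>)) ` {0<..<\<eta>0})"
      using G by (intro countable_subset[OF _ countable]) blast
    ultimately have "countable {0<..<\<eta>0}" by (rule countable_image_inj_on[rotated])
    then show ?thesis using uncountable_open_interval[of 0 \<eta>0] \<eta>0(1) by blast
  qed
qed

lemma closed_swept: "closed (swept T)"
proof -
  define G where "G = (\<lambda>p. F (fst p) (snd p))"
  have "continuous_on ({a..b} \<times> {0..T}) G"
    unfolding continuous_on_iff
  proof (intro ballI allI impI)
    fix p and e :: real assume p: "p \<in> {a..b} \<times> {0..T}" and e: "0 < e"
    obtain s t where st: "p = (s, t)" "s \<in> {a..b}" "0 \<le> t" using p by auto
    obtain d where d: "d > 0" "\<And>s'. s' \<in> {a..b} \<Longrightarrow> dist s' s < d \<Longrightarrow> dist (F s' t) (F s t) < e/2"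
      using cont[OF st(3)] st(2) e unfolding continuous_on_iff by (metis half_gt_zero)
    have "dist (G p') (G p) < e" if p': "p' \<in> {a..b} \<times> {0..T}" "dist p' p < min d (e/2)" for p'
    proof -
      obtain s' t' where st': "p' = (s', t')" "s' \<in> {a..b}" "0 \<le> t'" using p' by auto
      have "dist s' s < d" "dist t' t < e/2"
        using dist_fst_le[of p' p] dist_snd_le[of p' p] p'(2) st st' by auto
      then have "dist (F s' t) (F s t) < e/2" "dist (F s' t') (F s' t) < e/2"
        using d st' st distF[of s' t' t] by (auto simp: dist_real_def)
      then show ?thesis
        using dist_triangle[of "F s' t'" "F s t" "F s' t"] st st' by (simp add: G_def)
    qed
    then show "\<exists>d>0. \<forall>p'\<in>{a..b} \<times> {0..T}. dist p' p < d \<longrightarrow> dist (G p') (G p) < e"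
      using d e by (intro exI[of _ "min d (e/2)"]) auto
  qed
  then have "compact (G ` ({a..b} \<times> {0..T}))"
    by (intro compact_continuous_image compact_Times) auto
  moreover have "G ` ({a..b} \<times> {0..T}) = swept T"
    by (force simp: swept_def G_def)
  ultimately show ?thesis using compact_imp_closed by metis
qed

text \<open>
  Every point of the ball has a punctured neighbourhood that is contained in the swept set \<open>W\<close> or
  disjoint from it: for a regular point because \<open>W\<close> is closed and has the regular points that it
  shares with the ball in its interior, for a singular point because its punctured neighbourhoods
  are connected. The two alternatives define disjoint open sets \<open>E1\<close> and \<open>E2\<close>, and the ball is
  connected.
\<close>

lemma ball_subset_swept:
  assumes len: "length_space (UNIV :: 'b set)"
    and finite: "\<And>x r. finite (Z \<inter> cball x r)"
    and conical: "\<And>z. z \<in> Z \<Longrightarrow> \<exists>\<theta>>0. conical_at \<theta> z"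
    and s: "s \<in> {a..b}" and R: "0 < R" "R < t"
    and far: "\<And>u. 0 \<le> u \<Longrightarrow> R \<le> dist (F s t) (F a u)" "\<And>u. 0 \<le> u \<Longrightarrow> R \<le> dist (F s t) (F b u)"
  shows "ball (F s t) R \<subseteq> swept (t + R)"
proof -
  define w where "w = F s t"
  define W where "W = swept (t + R)"
  define B where "B = ball w R"
  have closed: "closed W" unfolding W_def by (rule closed_swept)
  have int: "y \<in> interior W" if y: "y \<in> B" "y \<in> W" "y \<notin> Z" for y
  proof -
    obtain s' t' where st': "y = F s' t'" "s' \<in> {a..b}" "0 \<le> t'"
      using y(2) by (auto simp: W_def swept_def)
    have "dist x0 w = t" "dist x0 y = t'" using dist_start s st' R by (auto simp: w_def)
    then have t': "0 < t'" "t' < t + R"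
      using y(1) R dist_triangle[of x0 w y] dist_triangle[of x0 y w] by (auto simp: B_def dist_commute)
    have "F a t' \<noteq> y" "F b t' \<noteq> y"
      using far[of t'] t' y(1) by (auto simp: B_def w_def)
    then have "\<exists>\<eta>>0. ball y \<eta> \<subseteq> W"
      unfolding W_def using swept_interior st' t' y(3) by blast
    then show ?thesis by (simp add: mem_interior)
  qed
  have perfect: "at y \<noteq> bot" if "y \<in> B" for y
  proof -
    have "connected B" unfolding B_def using len by (rule length_space_connected_ball)
    moreover have "F s t \<in> B" "F s (t + R/2) \<in> B" "F s (t + R/2) \<noteq> F s t"
      using distF[OF s, of t "t + R/2"] R by (auto simp: B_def w_def)
    then have "B \<noteq> {x}" for x by blast
    ultimately have "y islimpt B" using that by (intro connected_imp_perfect)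
    then have "y islimpt UNIV" by (rule islimpt_subset) simp
    then show ?thesis by (simp add: trivial_limit_within)
  qed
  define E1 where "E1 = {y \<in> B. eventually (\<lambda>u. u \<in> W) (at y)}"
  define E2 where "E2 = {y \<in> B. eventually (\<lambda>u. u \<notin> W) (at y)}"
  have split: "y \<in> E1 \<union> E2" if y: "y \<in> B" for y
  proof (cases "y \<in> Z")
    case False
    show ?thesis
    proof (cases "y \<in> W")
      case True
      then have "eventually (\<lambda>u. u \<in> W) (at y)"
        using int[OF y _ False] interior_subset[of W]
        unfolding eventually_at_topological by (intro exI[of _ "interior W"]) auto
      then show ?thesis using y by (simp add: E1_def)
    next
      case nW: False
      then have "eventually (\<lambda>u. u \<notin> W) (at y)"
        using closed unfolding eventually_at_topological by (intro exI[of _ "- W"]) auto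
      then show ?thesis using y by (simp add: E2_def)
    qed
  next
    case True
    obtain \<theta> where "0 < \<theta>" "conical_at \<theta> y" using conical[OF True] by blast
    then obtain e where e: "e > 0" "\<And>r. r \<le> e \<Longrightarrow> connected (ball y r - {y})"
      using conical_at_punctured_ball_connected by blast
    obtain d where d: "d > 0" "\<And>x. x \<in> Z \<inter> cball y 1 \<Longrightarrow> x \<noteq> y \<Longrightarrow> d \<le> dist y x"
      using finite_set_avoid[OF finite[of y 1], of y] by blast
    obtain c where c: "c > 0" "ball y c \<subseteq> B"
      using y open_contains_ball[of B] open_ball[of w R] unfolding B_def by metis
    define r where "r = Min {e, d, c, 1}"
    have r: "0 < r" "r \<le> e" "r \<le> d" "r \<le> c" "r \<le> 1" using e d c by (auto simp: r_def)
    define K where "K = ball y r - {y}"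
    have KZ: "x \<notin> Z" if "x \<in> K" for x
      using d(2)[of x] that r by (auto simp: K_def)
    have KB: "K \<subseteq> B" using c r by (auto simp: K_def subset_iff)
    have "K \<subseteq> interior W \<union> - W" using int KZ KB by blast
    moreover have "interior W \<inter> - W \<inter> K = {}" using interior_subset[of W] by blast
    moreover have "connected K" unfolding K_def using e(2) r(2) .
    ultimately have "interior W \<inter> K = {} \<or> - W \<inter> K = {}"
      using closed by (intro connectedD) auto
    then have "K \<subseteq> - W \<or> K \<subseteq> W" using int KZ KB by blast
    have ev: "eventually (\<lambda>u. u \<in> K) (at y)"
      unfolding eventually_at_topological K_def using r by (intro exI[of _ "ball y r"]) auto
    from \<open>K \<subseteq> - W \<or> K \<subseteq> W\<close> show ?thesis
    proof
      assume "K \<subseteq> - W"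
      then have "eventually (\<lambda>u. u \<notin> W) (at y)" by (intro eventually_mono[OF ev]) auto
      then show ?thesis using y by (simp add: E2_def)
    next
      assume "K \<subseteq> W"
      then have "eventually (\<lambda>u. u \<in> W) (at y)" by (intro eventually_mono[OF ev]) auto
      then show ?thesis using y by (simp add: E1_def)
    qed
  qed
  have nbhd: "open {y \<in> B. eventually P (at y)}" for P
    unfolding open_subopen[of "{y \<in> B. eventually P (at y)}"]
  proof
    fix y assume "y \<in> {y \<in> B. eventually P (at y)}"
    then obtain S where S: "open S" "y \<in> S" "\<And>u. u \<in> S \<Longrightarrow> u \<noteq> y \<Longrightarrow> P u" and y: "y \<in> B" "eventually P (at y)"
      unfolding eventually_at_topological by blast
    have "eventually P (at u)" if "u \<in> S" for u
    proof (cases "u = y")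
      case False
      then show ?thesis
        unfolding eventually_at_topological using S that by (intro exI[of _ "S - {y}"]) auto
    qed (use y in simp)
    then show "\<exists>T. open T \<and> y \<in> T \<and> T \<subseteq> {y \<in> B. eventually P (at y)}"
      using S(1,2) y(1) by (intro exI[of _ "S \<inter> B"]) (auto simp: B_def)
  qed
  have disj: "E1 \<inter> E2 = {}"
  proof -
    have False if y: "y \<in> E1" "y \<in> E2" for y
    proof -
      have "eventually (\<lambda>u. u \<in> W \<and> u \<notin> W) (at y)"
        using y unfolding E1_def E2_def by (intro eventually_conj) auto
      then have "eventually (\<lambda>u. False) (at y)" by (rule eventually_mono) simp
      then show False using perfect[of y] y(1) by (simp add: E1_def eventually_False)
    qed
    then show ?thesis by blast
  qed
  have "w \<in> E1"
  proof (rule ccontr)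
    have wB: "w \<in> B" using R by (simp add: B_def)
    assume "w \<notin> E1"
    then have "w \<in> E2" using split[OF wB] by blast
    then obtain d where d: "d > 0" "\<And>u. u \<noteq> w \<Longrightarrow> dist u w < d \<Longrightarrow> u \<notin> W"
      unfolding E2_def eventually_at by auto
    define h where "h = min R (d/2)"
    have h: "0 < h" "h \<le> R" "h < d" using d R by (auto simp: h_def)
    then have "F s (t + h) \<in> W" unfolding W_def swept_def using s R by force
    moreover have "dist (F s (t + h)) w = h" using distF[OF s, of "t + h" t] R h by (simp add: w_def)
    moreover from this have "F s (t + h) \<noteq> w" using h by (metis dist_self less_irrefl)
    ultimately show False using d(2)[of "F s (t + h)"] h by simp
  qed
  moreover have "connected B" unfolding B_def using len by (rule length_space_connected_ball)
  moreover have "open E1" "open E2" unfolding E1_def E2_def by (rule nbhd)+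
  moreover have "w \<in> B" using R by (simp add: B_def)
  ultimately have "E2 \<inter> B = {}"
    using connectedD[of B E1 E2] split disj by blast
  then have "B \<subseteq> E1" using split by blast
  moreover have "y \<in> W" if "y \<in> E1" for y
  proof (rule Lim_in_closed_set[OF closed])
    show "eventually (\<lambda>u. u \<in> W) (at y)" using that by (simp add: E1_def)
    show "at y \<noteq> bot" using perfect that by (simp add: E1_def)
    show "((\<lambda>u. u) \<longlongrightarrow> y) (at y)" by (rule tendsto_ident_at)
  qed
  ultimately show ?thesis unfolding B_def W_def w_def by blast
qed

text \<open>
  At a time when the extreme rays are far apart, some ray in between is far from both, by the
  intermediate value theorem. The ball of radius \<open>R\<close> around its point is swept and contains a cone
  point of small angle.
\<close>

lemma no_dense_small_cones:
  assumes len: "length_space (UNIV :: 'b set)"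
    and finite: "\<And>x r. finite (Z \<inter> cball x r)"
    and conical: "\<And>z. z \<in> Z \<Longrightarrow> \<exists>\<theta>>0. conical_at \<theta> z"
    and small: "\<And>w::'b. \<exists>z \<theta>. dist w z < R \<and> 0 < \<theta> \<and> \<theta> < 2 * pi \<and> conical_at \<theta> z"
    and diverge: "\<And>C. \<exists>t\<ge>0. C < dist (F a t) (F b t)"
  shows False
proof -
  have R: "0 < R" using small[of x0] zero_le_dist by (metis order_le_less_trans)
  obtain t where t: "0 \<le> t" "4 * R < dist (F a t) (F b t)" using diverge by blast
  have I: "a \<in> {a..b}" "b \<in> {a..b}" using ab by auto
  have "dist (F a t) (F b t) \<le> 2 * t"
    using dist_triangle3[of "F a t" "F b t" x0] dist_start[OF I(1) t(1)] dist_start[OF I(2) t(1)] by simp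
  then have tR: "R < t" using t R by linarith
  have "continuous_on {a..b} (\<lambda>s. dist (F s t) (F a t))"
    using cont[OF t(1)] by (intro continuous_intros)
  then obtain s where s: "s \<in> {a..b}" "dist (F s t) (F a t) = 2 * R"
    using IVT'[of "\<lambda>s. dist (F s t) (F a t)" a "2 * R" b] ab t R by (auto simp: dist_commute)
  have sb: "2 * R \<le> dist (F s t) (F b t)"
    using dist_triangle3[of "F a t" "F b t" "F s t"] s t by simp
  \<comment> \<open>Points of \<open>F c\<close> at a time that differs from \<open>t\<close> by at least \<open>R\<close> are far for that reason alone.\<close>
  have far: "R \<le> dist (F s t) (F c u)" if c: "c \<in> {a..b}" "2 * R \<le> dist (F s t) (F c t)" and u: "0 \<le> u" for c u
  proof -
    have "\<bar>t - u\<bar> \<le> dist (F s t) (F c u)"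
      using dist_triangle[of x0 "F s t" "F c u"] dist_triangle[of x0 "F c u" "F s t"]
        dist_start[OF s(1) t(1)] dist_start[OF c(1) u] by (simp add: dist_commute)
    moreover have "dist (F s t) (F c t) \<le> dist (F s t) (F c u) + \<bar>t - u\<bar>"
      using dist_triangle[of "F s t" "F c t" "F c u"] distF[OF c(1) u t(1)] by simp
    ultimately show ?thesis using c(2) by linarith
  qed
  have sub: "ball (F s t) R \<subseteq> swept (t + R)"
    using len finite conical s(1) R tR far[OF I(1)] far[OF I(2) sb] s(2)
    by (intro ball_subset_swept) auto
  obtain z \<theta> where z: "dist (F s t) z < R" "0 < \<theta>" "\<theta> < 2 * pi" "conical_at \<theta> z" using small by blast
  then obtain s' t' where st': "z = F s' t'" "s' \<in> {a..b}" "0 \<le> t'"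
    using sub by (auto simp: swept_def subset_iff)
  have "t \<le> dist (F s t) z + t'"
    using dist_triangle[of x0 "F s t" z] dist_start[OF s(1) t(1)] dist_start[OF st'(2,3)] st'(1) by (simp add: dist_commute)
  then have "0 < t'" using z tR by linarith
  then show False
    using geodesic_ray_avoids_small_cone[OF z(4,2,3) ray[OF st'(2)]] st'(1) by blast
qed

end

section \<open>Density of the ends of several rays\<close>

text \<open>
  The ray that follows \<open>q\<close> up to the meeting point and \<open>r\<close> afterwards has the same end as \<open>r\<close>.
\<close>

lemma unique_rays_agree_before_meeting:
  assumes unique: "\<And>r1 r2 t. geodesic_ray r1 \<Longrightarrow> geodesic_ray r2 \<Longrightarrow> r1 0 = x \<Longrightarrow> r2 0 = x \<Longrightarrow>
      ray_end r1 = ray_end r \<Longrightarrow> ray_end r2 = ray_end r \<Longrightarrow> 0 \<le> t \<Longrightarrow> r1 t = r2 t"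
    and r: "geodesic_ray r" "r 0 = x" and q: "geodesic_ray q" "q 0 = x"
    and u: "0 \<le> u" "u \<le> t" and eq: "q t = r t"
  shows "q u = r u"
proof -
  define c where "c v = (if v \<le> t then q v else r v)" for v
  have "geodesic_ray c" "ray_end c = ray_end r"
    using geodesic_ray_concat[OF q(1) r(1), of t] r q u eq by (simp_all add: c_def[abs_def])
  moreover have "c 0 = x" using u q by (simp add: c_def)
  ultimately have "c u = r u" using unique[of c r u] r u by simp
  then show ?thesis using u by (simp add: c_def)
qed

text \<open>
  The argument takes place in the total space of the covering. What the compact surface contributes
  is the uniform bound \<open>R\<close> for the distance to the next cone point of angle less than \<open>2\<pi>\<close>.
  The arc of boundary points consists of the \<open>\<Xi> s\<close>, which the homeomorphism with the circle
  maps to \<open>cis s\<close>.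
\<close>

lemma dense_multiple_rays:
  fixes x0 :: "'b::metric_space" and Z :: "'b set"
  assumes len: "length_space (UNIV :: 'b set)"
    and proper: "\<And>x r. compact (cball (x::'b) r)"
    and regular: "\<And>x. x \<notin> Z \<Longrightarrow> euclidean_at x"
    and finite: "\<And>x r. finite (Z \<inter> cball x r)"
    and conical: "\<And>z. z \<in> Z \<Longrightarrow> \<exists>\<theta>>0. conical_at \<theta> z"
    and small: "\<And>w::'b. \<exists>z \<theta>. dist w z < R \<and> 0 < \<theta> \<and> \<theta> < 2 * pi \<and> conical_at \<theta> z"
    and homeo: "boundary_topology x0 homeomorphic_space top_of_set (sphere (0::complex) 1)"
  shows "boundary_topology x0 closure_of
           {\<xi> \<in> visual_boundary. \<exists>r1 r2.
              geodesic_ray r1 \<and> geodesic_ray r2 \<and> (\<exists>t\<ge>0. r1 t \<noteq> r2 t) \<and>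
              r1 0 = x0 \<and> r2 0 = x0 \<and> ray_end r1 = \<xi> \<and> ray_end r2 = \<xi>}
         = visual_boundary"
    (is "_ closure_of ?Y = _")
proof -
  let ?X = "boundary_topology x0"
  let ?S = "top_of_set (sphere (0::complex) 1)"
  obtain h g where h: "continuous_map ?X ?S h" and g: "continuous_map ?S ?X g"
    and gh: "\<And>\<xi>. \<xi> \<in> visual_boundary \<Longrightarrow> g (h \<xi>) = \<xi>"
    and hg: "\<And>w. w \<in> sphere 0 1 \<Longrightarrow> h (g w) = w"
    using homeo unfolding homeomorphic_space_def homeomorphic_maps_def topspace_boundary_topology by auto
  have meets: "\<exists>\<zeta>\<in>?Y. \<zeta> \<in> U" if U: "openin ?X U" "\<xi> \<in> U" for \<xi> U
  proof (rule ccontr)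
    assume none: "\<not> (\<exists>\<zeta>\<in>?Y. \<zeta> \<in> U)"
    have UV: "U \<subseteq> visual_boundary" using openin_subset[OF U(1)] by (simp add: topspace_boundary_topology)
    have unique: "r1 t = r2 t"
      if "\<zeta> \<in> U" "geodesic_ray r1" "geodesic_ray r2" "r1 0 = x0" "r2 0 = x0" "ray_end r1 = \<zeta>" "ray_end r2 = \<zeta>" "0 \<le> t"
      for \<zeta> r1 r2 t
      using none UV that by blast
    obtain \<psi> where \<psi>: "h \<xi> = cis \<psi>"
    proof -
      have "h \<xi> \<in> sphere 0 1"
        using h U(2) UV by (auto simp: continuous_map_def topspace_boundary_topology)
      then show ?thesis using that complex_unimodular_polar[of "h \<xi>"] by (metis cis_conv_exp mem_sphere_0 cis.code complex_eq_iff)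
    qed
    have cis: "cis s \<in> sphere 0 1" for s by simp
    define V where "V = {w \<in> sphere 0 1. g w \<in> U}"
    have "openin ?S V"
      unfolding V_def using openin_continuous_map_preimage[OF g U(1)] by simp
    then obtain O1 where O1: "open O1" "V = sphere 0 1 \<inter> O1" by (auto simp: openin_open)
    have "open (cis -` O1)" using O1(1) by (intro open_vimage continuous_intros) auto
    moreover have "\<psi> \<in> cis -` O1"
    proof -
      have "g (cis \<psi>) = \<xi>" using gh[of \<xi>] U(2) UV \<psi> by auto
      then have "cis \<psi> \<in> V" using U(2) cis[of \<psi>] by (simp add: V_def)
      then show ?thesis using O1(2) by simp
    qed
    ultimately obtain e where e: "0 < e" "ball \<psi> e \<subseteq> cis -` O1"
      using open_contains_ball by metis
    define a where "a = \<psi>"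
    \<comment> \<open>The bound 1 makes the arc shorter than the circle.\<close>
    define b where "b = \<psi> + min (e/2) 1"
    have ab: "a < b" using e by (simp add: a_def b_def)
    define \<Xi> where "\<Xi> s = g (cis s)" for s
    have \<Xi>U: "\<Xi> s \<in> U" if "s \<in> {a..b}" for s
    proof -
      have "s \<in> ball \<psi> e" using that e by (auto simp: a_def b_def dist_real_def)
      then have "cis s \<in> V" using e(2) O1(2) by auto
      then show ?thesis by (simp add: V_def \<Xi>_def)
    qed
    have inj: "s = s'" if s: "s \<in> {a..b}" "s' \<in> {a..b}" "\<Xi> s = \<Xi> s'" for s s'
    proof -
      have "cis s = cis s'" using s(3) hg cis unfolding \<Xi>_def by metis
      then have "cos s = cos s'" "sin s = sin s'" by (metis cis.simps)+
      then have "cos \<bar>s - s'\<bar> = cos 0"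
        using sin_cos_squared_add3[of s'] by (simp add: cos_diff)
      moreover have "\<bar>s - s'\<bar> \<le> pi" using s pi_gt3 by (auto simp: a_def b_def)
      ultimately have "\<bar>s - s'\<bar> = 0" 
        by (rule cos_inj_pi[OF abs_ge_zero _ order_refl pi_ge_zero, rotated])
      then show ?thesis by simp
    qed
    have "\<exists>r. geodesic_ray r \<and> r 0 = x0 \<and> ray_end r = \<Xi> s" if "s \<in> {a..b}" for s
      using based_ray_exists[OF homeo, of "\<Xi> s"] \<Xi>U[OF that] UV by blast
    then obtain F where F: "\<And>s. s \<in> {a..b} \<Longrightarrow> geodesic_ray (F s)" "\<And>s. s \<in> {a..b} \<Longrightarrow> F s 0 = x0"
        "\<And>s. s \<in> {a..b} \<Longrightarrow> ray_end (F s) = \<Xi> s"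
      by metis
    have cont: "continuous_on {a..b} (\<lambda>s. F s t)" if t: "0 \<le> t" for t
      unfolding continuous_on_sequentially
    proof (intro allI impI ballI)
      fix \<sigma> s assume s: "s \<in> {a..b}" and "(\<forall>n. \<sigma> n \<in> {a..b}) \<and> \<sigma> \<longlonglongrightarrow> s"
      then have \<sigma>: "\<And>n. \<sigma> n \<in> {a..b}" "\<sigma> \<longlonglongrightarrow> s" by auto
      \<comment> \<open>A limit of a subsequence of the rays has the end \<open>\<Xi> s\<close>, as limits in the circle are
        unique, and is the ray \<open>F s\<close>, as there is only one ray with this end.\<close>
      have sub: "\<exists>\<rho>. strict_mono \<rho> \<and> (\<lambda>n. F (\<sigma> (\<kappa> (\<rho> n))) t) \<longlonglongrightarrow> F s t" if \<kappa>: "strict_mono \<kappa>" for \<kappa> :: "nat \<Rightarrow> nat"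
      proof -
        obtain \<rho> r where \<rho>: "strict_mono \<rho>" and r: "geodesic_ray r" "r 0 = x0"
            and lim: "\<And>t. 0 \<le> t \<Longrightarrow> (\<lambda>n. F (\<sigma> (\<kappa> (\<rho> n))) t) \<longlonglongrightarrow> r t"
          using geodesic_rays_convergent_subsequence[of x0 "\<lambda>n. F (\<sigma> (\<kappa> n))"] proper F(1,2) \<sigma>(1) by metis
        have "boundary_converges x0 (\<lambda>n. \<Xi> (\<sigma> (\<kappa> (\<rho> n)))) (ray_end r)"
          unfolding boundary_converges_def
          using F \<sigma>(1) r lim geodesic_rays_uniform_limit[of "\<lambda>n. F (\<sigma> (\<kappa> (\<rho> n)))" r]
          by (intro exI[of _ "\<lambda>n. F (\<sigma> (\<kappa> (\<rho> n)))"] exI[of _ r]) auto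
        then have "limitin ?S (h \<circ> (\<lambda>n. \<Xi> (\<sigma> (\<kappa> (\<rho> n))))) (h (ray_end r)) sequentially"
          using boundary_converges_limitin continuous_map_limit[OF h] by blast
        then have "(h \<circ> (\<lambda>n. \<Xi> (\<sigma> (\<kappa> (\<rho> n))))) \<longlonglongrightarrow> h (ray_end r)"
          by (simp add: limitin_subtopology)
        then have "(\<lambda>n. cis (\<sigma> (\<kappa> (\<rho> n)))) \<longlonglongrightarrow> h (ray_end r)"
          using hg[OF cis] by (simp add: o_def \<Xi>_def)
        moreover have "(\<lambda>n. \<sigma> ((\<kappa> \<circ> \<rho>) n)) \<longlonglongrightarrow> s"
          using LIMSEQ_subseq_LIMSEQ[OF \<sigma>(2) strict_mono_o[OF \<kappa> \<rho>]] by (simp add: o_def)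
        then have "(\<lambda>n. cis (\<sigma> (\<kappa> (\<rho> n)))) \<longlonglongrightarrow> cis s"
          unfolding o_def by (intro tendsto_cis)
        ultimately have "h (ray_end r) = cis s" by (rule LIMSEQ_unique)
        then have "ray_end r = \<Xi> s"
          using gh[OF ray_end_in_boundary[OF r(1)]] by (simp add: \<Xi>_def)
        then have "r t = F s t" using unique[OF \<Xi>U[OF s]] r F s t by blast
        then show ?thesis using \<rho> lim[OF t] by auto
      qed
      show "((\<lambda>s. F s t) \<circ> \<sigma>) \<longlonglongrightarrow> F s t"
      proof (rule ccontr)
        assume "\<not> ((\<lambda>s. F s t) \<circ> \<sigma>) \<longlonglongrightarrow> F s t"
        then obtain d where d: "d > 0" "\<not> eventually (\<lambda>n. dist (F (\<sigma> n) t) (F s t) < d) sequentially"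
          unfolding tendsto_iff by auto
        then have "\<exists>\<^sub>F n in sequentially. \<not> dist (F (\<sigma> n) t) (F s t) < d" by (simp add: not_eventually)
        then have "infinite {n. \<not> dist (F (\<sigma> n) t) (F s t) < d}"
          by (simp add: frequently_cofinite[symmetric] cofinite_eq_sequentially)
        then obtain \<kappa> :: "nat \<Rightarrow> nat" where \<kappa>: "strict_mono \<kappa>" "\<And>n. \<not> dist (F (\<sigma> (\<kappa> n)) t) (F s t) < d"
          using infinite_enumerate[of "{n. \<not> dist (F (\<sigma> n) t) (F s t) < d}"] by blast
        obtain \<rho> where "(\<lambda>n. F (\<sigma> (\<kappa> (\<rho> n))) t) \<longlonglongrightarrow> F s t" using sub[OF \<kappa>(1)] by blast
        then have "eventually (\<lambda>n. dist (F (\<sigma> (\<kappa> (\<rho> n))) t) (F s t) < d) sequentially"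
          using d(1) by (rule tendstoD)
        then show False using \<kappa>(2) by simp
      qed
    qed
    have nonasym: "\<exists>t\<ge>0. C < dist (F s t) (F s' t)" if "s \<in> {a..b}" "s' \<in> {a..b}" "s \<noteq> s'" for s s' C
    proof -
      have "ray_end (F s) \<noteq> ray_end (F s')" using F(3) inj that by metis
      then show ?thesis using ray_end_eq_iff[OF F(1) F(1)] that by (meson linorder_not_less)
    qed
    have "countable Z"
    proof -
      have "\<exists>n. z \<in> cball x0 (real n)" for z
        using real_arch_simple[of "dist x0 z"] by auto
      then have "Z = (\<Union>n. Z \<inter> cball x0 (real n))" by blast
      moreover have "countable (\<Union>n. Z \<inter> cball x0 (real n))"
        by (intro countable_UN countable_finite[OF finite] countableI_type)
      ultimately show ?thesis by simp
    qed
    interpret ray_sector F a b x0 Z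
    proof
      show "F s u = F s' u" if "s \<in> {a..b}" "s' \<in> {a..b}" "0 \<le> u" "u \<le> t" "F s t = F s' t" for s s' t u
      proof (rule unique_rays_agree_before_meeting)
        show "r1 v = r2 v"
          if "geodesic_ray r1" "geodesic_ray r2" "r1 0 = x0" "r2 0 = x0"
            "ray_end r1 = ray_end (F s')" "ray_end r2 = ray_end (F s')" "0 \<le> v" for r1 r2 v
          using unique[of "\<Xi> s'"] \<Xi>U F(3) \<open>s' \<in> {a..b}\<close> that by metis
      qed (use that F in auto)
      show "\<exists>t\<ge>0. F s t \<noteq> F s' t" if "s \<in> {a..b}" "s' \<in> {a..b}" "s \<noteq> s'" for s s'
        using nonasym[OF that, of 0] by (metis dist_self less_irrefl)
    qed (use ab F cont regular \<open>countable Z\<close> in auto)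
    show False
      using len finite conical small nonasym[of a b] ab by (intro no_dense_small_cones) auto
  qed
  show ?thesis
  proof
    show "?X closure_of ?Y \<subseteq> visual_boundary"
      using closure_of_subset_topspace[of ?X] by (simp add: topspace_boundary_topology)
    show "visual_boundary \<subseteq> ?X closure_of ?Y"
      using meets by (auto simp: in_closure_of topspace_boundary_topology)
  qed
qed

theorem proposition9:
  fixes P :: "'a::metric_space set"
    and \<theta> :: "'a \<Rightarrow> real"
    and p :: "'b::metric_space \<Rightarrow> 'a"
    and x0 :: 'b
  assumes "closed_surface (UNIV :: 'a set)"
    and "genus (UNIV :: 'a set) \<ge> 1"
    and "euclidean_cone_metric P \<theta>"
    and "\<exists>s\<in>P. \<theta> s < 2 * pi"
    and "metric_universal_covering p"
    and "hyperbolic_group (fundamental_group (p x0))"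
    and "boundary_topology x0 homeomorphic_space top_of_set (sphere (0::complex) 1)"
  shows "boundary_topology x0 closure_of
           {\<xi> \<in> visual_boundary. \<exists>r1 r2.
              geodesic_ray r1 \<and> geodesic_ray r2 \<and> (\<exists>t\<ge>0. r1 t \<noteq> r2 t) \<and>
              r1 0 = x0 \<and> r2 0 = x0 \<and> ray_end r1 = \<xi> \<and> ray_end r2 = \<xi>}
         = visual_boundary"
proof -
  have S: "compact (UNIV :: 'a set)" using assms(1) by (simp add: closed_surface_def)
  have lenS: "length_space (UNIV :: 'a set)" and P: "finite P"
    and eu: "\<And>x. x \<notin> P \<Longrightarrow> euclidean_at x"
    and co: "\<And>s. s \<in> P \<Longrightarrow> 0 < \<theta> s \<and> conical_at (\<theta> s) s"
    using assms(3) unfolding euclidean_cone_metric_def by blast+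
  have cov: "covering_space UNIV p UNIV" and len: "length_space (UNIV :: 'b set)" and loc: "local_isometry p"
    using assms(5) unfolding metric_universal_covering_def by blast+
  obtain s where s: "s \<in> P" "\<theta> s < 2 * pi" using assms(4) by blast
  obtain R where R: "\<And>(w::'b) s. \<exists>z. p z = s \<and> dist w z < R"
    using covering_fibre_dense[OF S lenS len cov loc] by blast
  have proper: "compact (cball (x::'b) r)" for x r
    by (rule covering_proper[OF S len cov loc])
  show ?thesis
  proof (rule dense_multiple_rays[where Z = "p -` P" and R = R])
    show "euclidean_at x" if "x \<notin> p -` P" for x
      using euclidean_at_lift[OF loc] eu that by simp
    show "finite (p -` P \<inter> cball x r)" for x r
      using proper loc P by (rule fibre_finite_cball)
    show "\<exists>\<theta>>0. conical_at \<theta> z" if "z \<in> p -` P" for z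
      using conical_at_lift[OF loc] co that by blast
    show "\<exists>z \<theta>. dist w z < R \<and> 0 < \<theta> \<and> \<theta> < 2 * pi \<and> conical_at \<theta> z" for w :: 'b
      using R[of s w] conical_at_lift[OF loc] co[OF s(1)] s(2) by metis
  qed (use len proper assms(7) in auto)
qed

end
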